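(* The functional $$J:W^{1,\infty}(0,1)\to[0,\infty],\qquad J(u)=\int_0^1\frac{u^2}{x^3}\,dx+\big\||u'|-1\big\|_{L^\infty(0,1)},$$ satisfies $$\inf_{u\in W^{1,\infty}(0,1)}J(u)=0,\qquad \inf_{u\in\mathcal B}J(u)=1 .$$
   Context: Let $\sigma(z)=\max\{z,0\}$. The (representational) Barron space $\mathcal B=\mathcal B(\mathbb R)$ is the space of functions $f:\mathbb R\to\mathbb R$ of the form $f(x)=\int_{S^1}\sigma(w\cdot(x,1))\,d\mu(w)$, where $\mu$ is a finite signed Borel measure on the unit circle $S^1\subset\mathbb R^2$. Barron functions are Lipschitz continuous, and $J$ is evaluated on their restrictions to $(0,1)$. (Known fact: a function on a bounded interval is the restriction of a Barron function if and only if it is weakly differentiable and its derivative is a function of bounded variation on the interval.) *)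

theory Defs
  imports "HOL-Analysis.Analysis" "HOL-Probability.Essential_Supremum"
begin

section \<open>Weak derivatives and Sobolev functions on an open subset of the line\<close>

text \<open>
  Functions on an open set \<open>\<Omega>\<close> are represented by total functions on the real line whose values
  outside \<open>\<Omega>\<close> are irrelevant: every notion below only looks at values on \<open>\<Omega>\<close>.
  Elements of Lebesgue and Sobolev spaces are represented by functions rather than by classes
  modulo almost everywhere equality.
\<close>

definition test_function :: "real set \<Rightarrow> (real \<Rightarrow> real) \<Rightarrow> bool" where
  "test_function \<Omega> \<phi> \<longleftrightarrow>
     (\<forall>k x. ((deriv ^^ k) \<phi>) differentiable (at x)) \<and>
     compact (closure {x. \<phi> x \<noteq> 0}) \<and> closure {x. \<phi> x \<noteq> 0} \<subseteq> \<Omega>"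

definition locally_integrable :: "real set \<Rightarrow> (real \<Rightarrow> real) \<Rightarrow> bool" where
  "locally_integrable \<Omega> u \<longleftrightarrow> (\<forall>K. compact K \<and> K \<subseteq> \<Omega> \<longrightarrow> set_integrable lebesgue K u)"

definition has_weak_derivative :: "real set \<Rightarrow> (real \<Rightarrow> real) \<Rightarrow> (real \<Rightarrow> real) \<Rightarrow> bool" where
  "has_weak_derivative \<Omega> u g \<longleftrightarrow>
     locally_integrable \<Omega> u \<and> locally_integrable \<Omega> g \<and>
     (\<forall>\<phi>. test_function \<Omega> \<phi> \<longrightarrow>
        (LINT x:\<Omega>|lebesgue. u x * deriv \<phi> x) = - (LINT x:\<Omega>|lebesgue. g x * \<phi> x))"

text \<open>A weak derivative is unique up to null sets; \<open>weak_deriv\<close> picks a representative.\<close>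

definition weak_deriv :: "real set \<Rightarrow> (real \<Rightarrow> real) \<Rightarrow> real \<Rightarrow> real" where
  "weak_deriv \<Omega> u = (SOME g. has_weak_derivative \<Omega> u g)"

text \<open>
  The essential supremum of a non-measurable function is infinite by convention, so finiteness of
  \<open>Linf_norm\<close> includes measurability.
\<close>

definition Linf_norm :: "real set \<Rightarrow> (real \<Rightarrow> real) \<Rightarrow> ennreal" where
  "Linf_norm \<Omega> f = esssup (lebesgue_on \<Omega>) (\<lambda>x. ennreal \<bar>f x\<bar>)"

definition Linf :: "real set \<Rightarrow> (real \<Rightarrow> real) set" where
  "Linf \<Omega> = {f. f \<in> borel_measurable (lebesgue_on \<Omega>) \<and> Linf_norm \<Omega> f < \<infinity>}"

definition W1_inf :: "real set \<Rightarrow> (real \<Rightarrow> real) set" where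
  "W1_inf \<Omega> = {u. u \<in> Linf \<Omega> \<and> (\<exists>g \<in> Linf \<Omega>. has_weak_derivative \<Omega> u g)}"

section \<open>Finite signed measures and Barron functions\<close>

text \<open>
  A finite signed measure on the measurable space underlying \<open>M\<close> (the measure of \<open>M\<close> itself plays
  no role).
\<close>

definition finite_signed_measure :: "'a measure \<Rightarrow> ('a set \<Rightarrow> real) \<Rightarrow> bool" where
  "finite_signed_measure M \<nu> \<longleftrightarrow>
     \<nu> {} = 0 \<and>
     (\<forall>A :: nat \<Rightarrow> 'a set. range A \<subseteq> sets M \<and> disjoint_family A \<longrightarrow>
        (\<lambda>i. \<nu> (A i)) sums \<nu> (\<Union>i. A i))"

text \<open>
  The positive part of the Jordan decomposition, \<open>A \<mapsto> sup {\<nu> B | B \<subseteq> A measurable}\<close>. Truncating the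
  negative values of \<open>\<nu>\<close> with \<^const>\<open>ennreal\<close> is harmless because \<open>B = {}\<close> contributes \<open>0\<close>.
\<close>

definition positive_variation :: "'a measure \<Rightarrow> ('a set \<Rightarrow> real) \<Rightarrow> 'a measure" where
  "positive_variation M \<nu> =
     measure_of (space M) (sets M) (\<lambda>A. SUP B \<in> {B \<in> sets M. B \<subseteq> A}. ennreal (\<nu> B))"

definition negative_variation :: "'a measure \<Rightarrow> ('a set \<Rightarrow> real) \<Rightarrow> 'a measure" where
  "negative_variation M \<nu> = positive_variation M (\<lambda>A. - \<nu> A)"

definition signed_integral :: "'a measure \<Rightarrow> ('a set \<Rightarrow> real) \<Rightarrow> ('a \<Rightarrow> real) \<Rightarrow> real" where
  "signed_integral M \<nu> f =
     integral\<^sup>L (positive_variation M \<nu>) f - integral\<^sup>L (negative_variation M \<nu>) f"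

definition relu :: "real \<Rightarrow> real" where
  "relu z = max z 0"

definition circle_borel :: "(real \<times> real) measure" where
  "circle_borel = restrict_space borel (sphere 0 1)"

definition barron :: "(real \<Rightarrow> real) set" where
  "barron = {f. \<exists>\<mu>. finite_signed_measure circle_borel \<mu> \<and>
     (\<forall>x. f x = signed_integral circle_borel \<mu> (\<lambda>w. relu (w \<bullet> (x, 1))))}"

section \<open>The functional\<close>

definition J :: "(real \<Rightarrow> real) \<Rightarrow> ennreal" where
  "J u = (\<integral>\<^sup>+x\<in>{0<..<1}. ennreal ((u x)\<^sup>2 / x ^ 3) \<partial>lebesgue)
       + Linf_norm {0<..<1} (\<lambda>x. \<bar>weak_deriv {0<..<1} u x\<bar> - 1)"

end

theory Submission
  imports Defs
begin

text \<open>
  Over \<^term>\<open>W1_inf {0<..<1}\<close>, the oscillating functions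
  \<open>\<epsilon> x\<^sup>2 arcsin (sin (1 / (\<epsilon> x)))\<close> have slopes within \<open>O(\<epsilon>)\<close> of \<open>\<plusminus>1\<close> almost everywhere and
  are \<open>O(\<epsilon> x\<^sup>2)\<close>, so both terms of the functional are \<open>O(\<epsilon>)\<close>.

  A Barron function cannot oscillate in this way: by dominated convergence its derivative has a limit
  \<open>L\<close> at \<open>0\<close> from the right, and \<open>L\<close> is also its one-sided derivative at \<open>0\<close>. If the functional
  is smaller than \<open>1\<close>, then the slopes are bounded away from \<open>0\<close>, hence \<open>L \<noteq> 0\<close> and
  \<open>\<bar>u x\<bar> \<ge> c x\<close> near \<open>0\<close> for some \<open>c > 0\<close>; then the integral of \<open>u\<^sup>2 / x\<^sup>3\<close> diverges
  like that of \<open>1 / x\<close>. The zero function attains the value \<open>1\<close>.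
\<close>

section \<open>Smooth bumps and uniqueness of weak derivatives\<close>

text \<open>The classical function that is flat at the origin, with a polynomial factor in
  \<open>1 / x\<close> so that the family is closed under differentiation. The rate \<open>t\<close>
  is kept as a parameter because it is later sent to 0.\<close>

definition cutoff :: "real \<Rightarrow> real poly \<Rightarrow> real \<Rightarrow> real" where
  "cutoff t p x = (if 0 < x then poly p (1 / x) * exp (- t / x) else 0)"

lemma poly_mult_exp_neg_tendsto_0:
  fixes t :: real
  assumes "0 < t"
  shows "((\<lambda>y. poly p y * exp (- (t * y))) \<longlongrightarrow> 0) at_top"
proof -
  have pw: "((\<lambda>y. y ^ k * exp (- (t * y))) \<longlongrightarrow> 0) at_top" for k
  proof -
    have "filterlim (\<lambda>y. t * y) at_top at_top"
      using assms by (simp add: filterlim_tendsto_pos_mult_at_top[OF tendsto_const _ filterlim_ident])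
    from filterlim_compose[OF tendsto_power_div_exp_0 this]
    have "((\<lambda>y. (1 / t ^ k) * ((t * y) ^ k / exp (t * y))) \<longlongrightarrow> (1 / t ^ k) * 0) at_top"
      by (intro tendsto_intros)
    then show ?thesis
      using assms by (simp add: exp_minus field_simps power_mult_distrib)
  qed
  have "((\<lambda>y. \<Sum>i\<le>degree p. coeff p i * (y ^ i * exp (- (t * y)))) \<longlongrightarrow> (\<Sum>i\<le>degree p. coeff p i * 0)) at_top"
    by (intro tendsto_intros pw)
  then show ?thesis
    by (simp add: poly_altdef sum_distrib_right mult.assoc)
qed

text \<open>In the variable y = 1/x, differentiation in x is -y^2 d/dy, which sends p(y) exp(-ty) to
  y^2 (t p - p')(y) exp(-ty). At the origin the exponential decay beats every polynomial in
  y.\<close>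

lemma cutoff_has_derivative:
  assumes t: "0 < t"
  shows "(cutoff t p has_real_derivative
    cutoff t ([:0, 0, 1:] * (smult t p - pderiv p)) x) (at x)"
proof -
  consider "x > 0" | "x = 0" | "x < 0" by linarith
  then show ?thesis
  proof cases
    case 1
    have "((\<lambda>x. poly p (1 / x) * exp (- t / x)) has_real_derivative
        cutoff t ([:0, 0, 1:] * (smult t p - pderiv p)) x) (at x)"
      using 1 by (auto intro!: derivative_eq_intros simp: cutoff_def field_simps power2_eq_square)
    then show ?thesis
    proof (rule has_field_derivative_transform_within_open[of _ _ _ "{0<..}"])
    qed (use 1 in \<open>auto simp: cutoff_def\<close>)
  next
    case 3
    have "((\<lambda>x. 0) has_real_derivative 0) (at x)" by simp
    then have "(cutoff t p has_real_derivative 0) (at x)"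
      by (rule has_field_derivative_transform_within_open[of _ _ _ "{..<0}"])
        (use 3 in \<open>auto simp: cutoff_def\<close>)
    then show ?thesis using 3 by (simp add: cutoff_def)
  next
    case 2
    have r: "((\<lambda>x. cutoff t p x / x) \<longlongrightarrow> 0) (at_right 0)"
    proof -
      \<comment> \<open>Dividing by x multiplies the polynomial by y = 1/x, so the difference
        quotient at 0 is again of the decaying form.\<close>
      have "((\<lambda>y. poly ([:0,1:] * p) y * exp (- (t * y))) \<longlongrightarrow> 0) at_top"
        by (rule poly_mult_exp_neg_tendsto_0[OF t])
      then have "((\<lambda>x. poly ([:0,1:] * p) (inverse x) * exp (- (t * inverse x))) \<longlongrightarrow> 0) (at_right 0)"
        by (rule filterlim_compose[OF _ filterlim_inverse_at_top_right])
      then show ?thesis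
      proof (rule Lim_transform_eventually)
        show "\<forall>\<^sub>F x in at_right 0. poly ([:0,1:] * p) (inverse x) * exp (- (t * inverse x)) = cutoff t p x / x"
          using eventually_at_right_less[of 0]
          by eventually_elim (auto simp: cutoff_def divide_simps)
      qed
    qed
    have l: "((\<lambda>x. cutoff t p x / x) \<longlongrightarrow> 0) (at_left 0)"
      by (rule Lim_transform_eventually[OF tendsto_const])
        (auto simp: cutoff_def eventually_at_filter)
    have "((\<lambda>x. cutoff t p x / x) \<longlongrightarrow> 0) (at 0)"
      using l r by (simp add: filterlim_at_split)
    then show ?thesis
      using 2 by (simp add: has_field_derivative_iff cutoff_def)
  qed
qed

text \<open>A class of functions closed under differentiation, which makes its members smooth.\<close>

inductive_set bump_span :: "real \<Rightarrow> real \<Rightarrow> real \<Rightarrow> (real \<Rightarrow> real) set" for t c d where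
  prod: "(\<lambda>x. cutoff t p (x - c) * cutoff t q (d - x)) \<in> bump_span t c d"
| add: "f \<in> bump_span t c d \<Longrightarrow> g \<in> bump_span t c d \<Longrightarrow> (\<lambda>x. f x + g x) \<in> bump_span t c d"

text \<open>The product rule yields two products of the same shape: differentiation changes only the
  polynomials, and the sign coming from the reflected argument \<open>d - x\<close> is absorbed by
  negating one of them.\<close>

lemma bump_span_has_derivative:
  assumes t: "0 < t" and "f \<in> bump_span t c d"
  shows "\<exists>f' \<in> bump_span t c d. \<forall>x. (f has_real_derivative f' x) (at x)"
  using assms(2)
proof induction
  case (prod p q)
  let ?D = "\<lambda>p. [:0, 0, 1:] * (smult t p - pderiv p)"
  have neg: "cutoff t (- q) x = - cutoff t q x" for q x
    by (simp add: cutoff_def)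
  have l: "((\<lambda>x. cutoff t p (x - c)) has_real_derivative cutoff t (?D p) (x - c)) (at x)" for x
    by (rule DERIV_cong[OF DERIV_chain'[OF _ cutoff_has_derivative[OF t], of _ 1]])
      (auto intro!: derivative_eq_intros)
  have r: "((\<lambda>x. cutoff t q (d - x)) has_real_derivative cutoff t (- ?D q) (d - x)) (at x)" for x
    unfolding neg
    by (rule DERIV_cong[OF DERIV_chain'[OF _ cutoff_has_derivative[OF t], of _ "-1"]])
      (auto intro!: derivative_eq_intros)
  show ?case
    by (rule bexI[OF _ bump_span.add[OF bump_span.prod[of t "?D p" c q d] bump_span.prod[of t p c "- ?D q" d]]])
      (use DERIV_mult[OF l r] in \<open>auto simp: mult.commute add.commute\<close>)
next
  case (add f g)
  then obtain f' g' where "f' \<in> bump_span t c d" "g' \<in> bump_span t c d"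
    "\<And>x. (f has_real_derivative f' x) (at x)" "\<And>x. (g has_real_derivative g' x) (at x)"
    by blast
  then show ?case
    by (intro bexI[of _ "\<lambda>x. f' x + g' x"]) (auto intro: bump_span.add DERIV_add)
qed

lemma bump_span_higher_deriv:
  assumes t: "0 < t" and f: "f \<in> bump_span t c d"
  shows "(deriv ^^ k) f \<in> bump_span t c d"
proof (induction k)
  case 0
  then show ?case using f by simp
next
  case (Suc k)
  from bump_span_has_derivative[OF t this] obtain f' where f': "f' \<in> bump_span t c d"
    "\<forall>x. ((deriv ^^ k) f has_real_derivative f' x) (at x)" by blast
  then have "deriv ((deriv ^^ k) f) = f'"
    by (auto intro: DERIV_imp_deriv)
  then show ?case using f' by simp
qed

definition bump :: "real \<Rightarrow> real \<Rightarrow> real \<Rightarrow> real \<Rightarrow> real" where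
  "bump t c d x = cutoff t 1 (x - c) * cutoff t 1 (d - x)"

lemma bump_eq: "bump t c d x = (if c < x \<and> x < d then exp (- t * (1 / (x - c) + 1 / (d - x))) else 0)"
  by (simp add: bump_def cutoff_def mult_exp_exp distrib_left)

lemma bump_bounds: "0 < t \<Longrightarrow> 0 \<le> bump t c d x \<and> bump t c d x \<le> 1"
  by (auto simp: bump_eq)

lemma test_function_bump:
  assumes t: "0 < t" and "{c..d} \<subseteq> \<Omega>"
  shows "test_function \<Omega> (bump t c d)"
proof -
  have b: "bump t c d \<in> bump_span t c d"
    unfolding bump_def[abs_def] by (rule bump_span.prod)
  have "(deriv ^^ k) (bump t c d) differentiable (at x)" for k x
    using bump_span_has_derivative[OF t bump_span_higher_deriv[OF t b, of k]]
    by (auto simp: real_differentiable_def)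
  moreover have sub: "closure {x. bump t c d x \<noteq> 0} \<subseteq> {c..d}"
    by (rule closure_minimal) (auto simp: bump_eq split: if_splits)
  moreover have "compact (closure {x. bump t c d x \<noteq> 0})"
    using compact_Int_closed[OF compact_Icc closed_closure] sub by (metis inf.absorb_iff2)
  ultimately show ?thesis using assms by (auto simp: test_function_def)
qed

text \<open>Sending the rate \<open>t\<close> to 0 removes the exponential damping inside the
  interval, while outside it the bumps vanish for every \<open>t\<close>.\<close>

lemma bump_tendsto_indicator:
  "((\<lambda>n. bump (1 / real (Suc n)) c d x) \<longlonglongrightarrow> indicator {c<..<d} x)"
proof (cases "c < x \<and> x < d")
  case True
  have "(\<lambda>n. exp (- (1 / real (Suc n)) * (1 / (x - c) + 1 / (d - x)))) \<longlonglongrightarrow> exp (- 0 * (1 / (x - c) + 1 / (d - x)))"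
    by (intro tendsto_intros LIMSEQ_Suc[OF lim_1_over_n])
  then show ?thesis using True by (simp add: bump_eq)
qed (auto simp: bump_eq)

lemma bump_measurable [measurable]: "bump t c d \<in> borel_measurable borel"
  unfolding bump_eq[abs_def] by measurable

section \<open>Integrals that force a function to vanish almost everywhere\<close>

lemma AE_eq_0_of_Ioi_integrals_lborel:
  fixes h :: "real \<Rightarrow> real"
  assumes h: "integrable lborel h" and z: "\<And>x. (LINT y:{x<..}|lborel. h y) = 0"
  shows "AE x in lborel. h x = 0"
proof -
  have [measurable]: "h \<in> borel_measurable borel" using h by auto
  have fin: "(\<integral>\<^sup>+x. ennreal (h x) * indicator A x \<partial>lborel) < \<infinity>" 
            "(\<integral>\<^sup>+x. ennreal (- h x) * indicator A x \<partial>lborel) < \<infinity>" for A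
  proof -
    have "(\<integral>\<^sup>+x. ennreal (norm (h x)) \<partial>lborel) < \<infinity>" using h by (simp add: integrable_iff_bounded)
    moreover have "(\<integral>\<^sup>+x. ennreal (h x) * indicator A x \<partial>lborel) \<le> (\<integral>\<^sup>+x. ennreal (norm (h x)) \<partial>lborel)"
      "(\<integral>\<^sup>+x. ennreal (- h x) * indicator A x \<partial>lborel) \<le> (\<integral>\<^sup>+x. ennreal (norm (h x)) \<partial>lborel)"
      by (auto intro!: nn_integral_mono ennreal_leI split: split_indicator)
    ultimately show "(\<integral>\<^sup>+x. ennreal (h x) * indicator A x \<partial>lborel) < \<infinity>" 
            "(\<integral>\<^sup>+x. ennreal (- h x) * indicator A x \<partial>lborel) < \<infinity>"
      by (auto intro: order.strict_trans1)
  qed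
  \<comment> \<open>Since \<open>ennreal\<close> truncates at 0, the two densities are the positive
    and the negative part of \<open>h\<close>. The measures agree on all rays, with finite values
    there, and are therefore equal.\<close>
  have "density lborel (\<lambda>x. ennreal (h x)) = density lborel (\<lambda>x. ennreal (- h x))"
  proof (rule measure_eqI_lessThan)
    fix x
    have i: "integrable lborel (\<lambda>y. indicator {x<..} y * h y)"
      using integrable_mult_indicator[OF _ h, of "{x<..}"] by simp
    have e: "(\<integral>\<^sup>+y. ennreal (indicator {x<..} y * h y) \<partial>lborel) = (\<integral>\<^sup>+y. ennreal (h y) * indicator {x<..} y \<partial>lborel)"
      "(\<integral>\<^sup>+y. ennreal (- (indicator {x<..} y * h y)) \<partial>lborel) = (\<integral>\<^sup>+y. ennreal (- h y) * indicator {x<..} y \<partial>lborel)"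
      by (auto intro!: nn_integral_cong split: split_indicator)
    have "(LINT y|lborel. indicator {x<..} y * h y) = 0"
      using z[of x] by (simp add: set_lebesgue_integral_def)
    then have "enn2real (\<integral>\<^sup>+y. ennreal (h y) * indicator {x<..} y \<partial>lborel) 
      = enn2real (\<integral>\<^sup>+y. ennreal (- h y) * indicator {x<..} y \<partial>lborel)"
      using real_lebesgue_integral_def[OF i] by (simp add: e)
    then have "(\<integral>\<^sup>+y. ennreal (h y) * indicator {x<..} y \<partial>lborel) = (\<integral>\<^sup>+y. ennreal (- h y) * indicator {x<..} y \<partial>lborel)"
      using fin[of "{x<..}"] by (metis ennreal_enn2real infinity_ennreal_def)
    then show "emeasure (density lborel (\<lambda>x. ennreal (h x))) {x<..} = emeasure (density lborel (\<lambda>x. ennreal (- h x))) {x<..}"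
      by (simp add: emeasure_density)
    show "emeasure (density lborel (\<lambda>x. ennreal (h x))) {x<..} < \<infinity>"
      using fin by (simp add: emeasure_density)
  qed auto
  then have "AE x in lborel. ennreal (h x) = ennreal (- h x)"
    by (subst (asm) sigma_finite_measure.density_unique_iff[OF sigma_finite_lborel]) auto
  \<comment> \<open>At most one of \<open>ennreal (h x)\<close> and \<open>ennreal (- h x)\<close>
    is nonzero, so their equality makes both vanish.\<close>
  then show ?thesis
  proof eventually_elim
    case (elim x)
    then show ?case by (cases "h x \<ge> 0") (auto simp: ennreal_neg ennreal_eq_0_iff)
  qed
qed

text \<open>Transfer from \<open>lborel\<close> to \<open>lebesgue\<close>: \<open>h\<close> is
  replaced by a Borel function that equals it almost everywhere.\<close>

lemma AE_eq_0_of_Ioi_integrals: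
  fixes h :: "real \<Rightarrow> real"
  assumes h: "integrable lebesgue h" and z: "\<And>x. (LINT y:{x<..}|lebesgue. h y) = 0"
  shows "AE x in lebesgue. h x = 0"
proof -
  from completion_ex_borel_measurable_real[OF borel_measurable_integrable[OF h]]
  obtain g where g [measurable]: "g \<in> borel_measurable lborel" and ae: "AE x in lborel. h x = g x"
    by blast
  have ae': "AE x in lebesgue. h x = g x" using AE_completion[OF ae] .
  have gm: "g \<in> borel_measurable lebesgue" using g by (rule measurable_completion)
  have "integrable lebesgue g"
    by (rule Bochner_Integration.integrable_cong_AE_imp[OF h gm]) (use ae' in auto)
  then have i: "integrable lborel g" by (simp add: integrable_completion)
  have "(LINT y:{x<..}|lborel. g y) = 0" for x
  proof -
    have "(LINT y:{x<..}|lborel. g y) = (LINT y:{x<..}|lebesgue. g y)"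
      unfolding set_lebesgue_integral_def by (rule integral_completion[symmetric]) measurable
    also have "\<dots> = (LINT y:{x<..}|lebesgue. h y)"
      unfolding set_lebesgue_integral_def
    proof (rule integral_cong_AE)
      show "(\<lambda>y. indicator {x<..} y *\<^sub>R g y) \<in> borel_measurable lebesgue"
        by (intro measurable_completion) measurable
      show "(\<lambda>y. indicator {x<..} y *\<^sub>R h y) \<in> borel_measurable lebesgue"
        using h by (intro borel_measurable_scaleR borel_measurable_indicator) auto
    qed (use ae' in auto)
    finally show ?thesis using z by simp
  qed
  from AE_eq_0_of_Ioi_integrals_lborel[OF i this] have "AE x in lebesgue. g x = 0"
    by (rule AE_completion)
  with ae' show ?thesis by eventually_elim simp
qed

text \<open>Local integrability controls \<open>u\<close> on compact sets only; a bounded factor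
  vanishing off \<open>K\<close> reduces the integral over \<open>\<Omega>\<close> to one over
  \<open>K\<close>.\<close>

lemma set_integrable_mult_compact_support:
  fixes u \<psi> :: "real \<Rightarrow> real"
  assumes u: "locally_integrable \<Omega> u" and K: "compact K" "K \<subseteq> \<Omega>"
    and \<psi>: "\<psi> \<in> borel_measurable borel" "\<And>x. x \<in> K \<Longrightarrow> \<bar>\<psi> x\<bar> \<le> C" "\<And>x. x \<notin> K \<Longrightarrow> \<psi> x = 0"
  shows "set_integrable lebesgue \<Omega> (\<lambda>x. u x * \<psi> x)"
    and "(LINT x:\<Omega>|lebesgue. u x * \<psi> x) = (LINT x:K|lebesgue. u x * \<psi> x)"
proof -
  have eq: "(\<lambda>x. indicator \<Omega> x *\<^sub>R (u x * \<psi> x)) = (\<lambda>x. indicator K x *\<^sub>R (u x * \<psi> x))"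
    using K \<psi>(3) by (force simp: fun_eq_iff split: split_indicator)
  have i: "integrable lebesgue (\<lambda>x. indicator K x *\<^sub>R u x)"
    using u K by (auto simp: locally_integrable_def set_integrable_def)
  have m: "\<psi> \<in> borel_measurable lebesgue"
    using \<psi>(1) by (simp add: measurable_completion)
  have "integrable lebesgue (\<lambda>x. C * (indicator K x *\<^sub>R u x))" using i by (intro integrable_mult_right)
  then have "integrable lebesgue (\<lambda>x. (indicator K x *\<^sub>R u x) * \<psi> x)"
  proof (rule Bochner_Integration.integrable_bound)
    show "(\<lambda>x. (indicator K x *\<^sub>R u x) * \<psi> x) \<in> borel_measurable lebesgue"
      using borel_measurable_integrable[OF i] m by (rule borel_measurable_times)
    show "AE x in lebesgue. norm ((indicator K x *\<^sub>R u x) * \<psi> x) \<le> norm (C * (indicator K x *\<^sub>R u x))"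
    proof (rule AE_I2)
      fix x
      show "norm ((indicator K x *\<^sub>R u x) * \<psi> x) \<le> norm (C * (indicator K x *\<^sub>R u x))"
        using \<psi>(2)[of x] by (auto simp: abs_mult mult.commute[of "\<bar>u x\<bar>"] split: split_indicator intro!: mult_right_mono)
    qed
  qed
  then show "set_integrable lebesgue \<Omega> (\<lambda>x. u x * \<psi> x)"
    unfolding set_integrable_def eq by (simp add: mult.assoc)
  show "(LINT x:\<Omega>|lebesgue. u x * \<psi> x) = (LINT x:K|lebesgue. u x * \<psi> x)"
    unfolding set_lebesgue_integral_def eq ..
qed

text \<open>The fundamental lemma of the calculus of variations. By dominated convergence the bumps
  may be replaced by indicators of intervals; vanishing integrals over intervals then give
  \<open>h = 0\<close> almost everywhere on each interval compactly inside
  \<open>\<Omega>\<close>.\<close>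

lemma AE_eq_0_of_bump_integrals:
  assumes "open \<Omega>" and h: "locally_integrable \<Omega> h"
    and z: "\<And>t c d. 0 < t \<Longrightarrow> {c..d} \<subseteq> \<Omega> \<Longrightarrow> (LINT x:\<Omega>|lebesgue. h x * bump t c d x) = 0"
  shows "AE x in lebesgue. x \<in> \<Omega> \<longrightarrow> h x = 0"
proof -
  have int0: "(LINT x:{c<..<d}|lebesgue. h x) = 0" if cd: "{c..d} \<subseteq> \<Omega>" for c d
  proof -
    have hi: "integrable lebesgue (\<lambda>x. indicator {c..d} x *\<^sub>R h x)"
      using h cd by (auto simp: locally_integrable_def set_integrable_def)
    let ?s = "\<lambda>n x. (indicator {c..d} x *\<^sub>R h x) * bump (1 / real (Suc n)) c d x"
    have bm: "bump t c d \<in> borel_measurable lebesgue" for t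
      using bump_measurable by (simp add: measurable_completion)
    have "(\<lambda>n. LINT x|lebesgue. ?s n x) \<longlonglongrightarrow> (LINT x|lebesgue. (indicator {c..d} x *\<^sub>R h x) * indicator {c<..<d} x)"
    proof (rule integral_dominated_convergence)
      show "integrable lebesgue (\<lambda>x. norm (indicator {c..d} x *\<^sub>R h x))" using hi by simp
      show "AE x in lebesgue. (\<lambda>n. ?s n x) \<longlonglongrightarrow> (indicator {c..d} x *\<^sub>R h x) * indicator {c<..<d} x"
        by (intro AE_I2 tendsto_mult tendsto_const bump_tendsto_indicator)
      show "AE x in lebesgue. norm (?s n x) \<le> norm (indicator {c..d} x *\<^sub>R h x)" for n
      proof (rule AE_I2)
        fix x
        show "norm (?s n x) \<le> norm (indicator {c..d} x *\<^sub>R h x)"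
          using bump_bounds[of "1 / real (Suc n)" c d x]
          by (auto simp: abs_mult mult.commute split: split_indicator intro!: mult_left_le)
      qed
      show "?s n \<in> borel_measurable lebesgue" for n
        by (intro borel_measurable_times borel_measurable_integrable[OF hi] bm)
      show "(\<lambda>x. (indicator {c..d} x *\<^sub>R h x) * indicator {c<..<d} x) \<in> borel_measurable lebesgue"
        by (intro borel_measurable_times borel_measurable_integrable[OF hi] borel_measurable_indicator) auto
    qed
    moreover have "(LINT x|lebesgue. ?s n x) = 0" for n
    proof -
      have "(LINT x|lebesgue. ?s n x) = (LINT x:\<Omega>|lebesgue. h x * bump (1 / real (Suc n)) c d x)"
        unfolding set_lebesgue_integral_def
        by (intro Bochner_Integration.integral_cong refl)
          (use subsetD[OF cd] in \<open>auto simp: bump_eq indicator_def\<close>)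
      then show ?thesis using z cd by simp
    qed
    moreover have "(\<lambda>x. (indicator {c..d} x *\<^sub>R h x) * indicator {c<..<d} x) = (\<lambda>x. indicator {c<..<d} x *\<^sub>R h x)"
      by (auto split: split_indicator)
    ultimately show ?thesis
      by (simp add: set_lebesgue_integral_def LIMSEQ_const_iff)
  qed
  have ae: "AE x in lebesgue. x \<in> {c<..<d} \<longrightarrow> h x = 0" if cd: "{c..d} \<subseteq> \<Omega>" for c d
  proof -
    have hi: "set_integrable lebesgue {c<..<d} h"
      by (rule set_integrable_subset[of _ "{c..d}"]) (use h cd in \<open>auto simp: locally_integrable_def\<close>)
    have "AE x in lebesgue. indicator {c<..<d} x *\<^sub>R h x = 0"
    proof (rule AE_eq_0_of_Ioi_integrals)
      fix x
      \<comment> \<open>A ray meets (c,d) in an interval, possibly empty, to which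
        \<open>int0\<close> applies again.\<close>
      have "(LINT y:{x<..}|lebesgue. indicator {c<..<d} y *\<^sub>R h y) = (LINT y:{max x c<..<d}|lebesgue. h y)"
        unfolding set_lebesgue_integral_def
        by (intro Bochner_Integration.integral_cong refl) (auto split: split_indicator)
      also have "\<dots> = 0" using cd by (intro int0) auto
      finally show "(LINT y:{x<..}|lebesgue. indicator {c<..<d} y *\<^sub>R h y) = 0" .
    qed (use hi in \<open>simp add: set_integrable_def\<close>)
    then show ?thesis by eventually_elim auto
  qed
  \<comment> \<open>Intervals with rational endpoints already cover \<open>\<Omega>\<close>, so only
    countably many null sets have to be united.\<close>
  let ?I = "{(c, d) \<in> \<rat> \<times> \<rat>. {c..d::real} \<subseteq> \<Omega>}"
  have "countable ?I" by (rule countable_subset[of _ "\<rat> \<times> \<rat>"]) (auto intro: countable_rat)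
  then have "AE x in lebesgue. \<forall>i\<in>?I. x \<in> {fst i<..<snd i} \<longrightarrow> h x = 0"
    using ae by (subst AE_ball_countable) auto
  then show ?thesis
  proof eventually_elim
    case (elim x)
    show ?case
    proof
      assume "x \<in> \<Omega>"
      then obtain e where e: "e > 0" "ball x e \<subseteq> \<Omega>"
        using \<open>open \<Omega>\<close> openE by blast
      obtain c where c: "c \<in> \<rat>" "x - e < c" "c < x" using Rats_dense_in_real[of "x - e" x] e by auto
      obtain d where d: "d \<in> \<rat>" "x < d" "d < x + e" using Rats_dense_in_real[of x "x + e"] e by auto
      have "{c..d} \<subseteq> ball x e" using c d by (auto simp: dist_real_def)
      then show "h x = 0" using elim c d e by fastforce
    qed
  qed
qed

section \<open>Test functions as multipliers and uniqueness of weak derivatives\<close>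

lemma locally_integrable_diff:
  "locally_integrable \<Omega> u \<Longrightarrow> locally_integrable \<Omega> v \<Longrightarrow> locally_integrable \<Omega> (\<lambda>x. u x - v x)"
  by (auto simp: locally_integrable_def intro!: set_integral_diff)

text \<open>\<open>K\<close> is the closed support. Its complement is open and \<open>\<phi>\<close>
  is zero there, so \<open>deriv \<phi>\<close> vanishes there too; continuity on the compact set
  \<open>K\<close> provides the common bound \<open>C\<close>.\<close>

lemma test_functionD:
  assumes "test_function \<Omega> \<phi>"
  obtains K C where "compact K" "K \<subseteq> \<Omega>" "\<And>x. x \<notin> K \<Longrightarrow> \<phi> x = 0" "\<And>x. x \<notin> K \<Longrightarrow> deriv \<phi> x = 0"
    "\<And>x. \<bar>\<phi> x\<bar> \<le> C" "\<And>x. \<bar>deriv \<phi> x\<bar> \<le> C"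
    "\<And>x. (\<phi> has_real_derivative deriv \<phi> x) (at x)" "continuous_on UNIV \<phi>" "continuous_on UNIV (deriv \<phi>)"
proof -
  define K where "K = closure {x. \<phi> x \<noteq> 0}"
  have K: "compact K" "K \<subseteq> \<Omega>" and zK: "\<And>x. x \<notin> K \<Longrightarrow> \<phi> x = 0"
    using assms closure_subset[of "{x. \<phi> x \<noteq> 0}"] by (auto simp: K_def test_function_def)
  have diff: "((deriv ^^ k) \<phi>) differentiable (at x)" for k x
    using assms by (auto simp: test_function_def)
  have d: "(\<phi> has_real_derivative deriv \<phi> x) (at x)" for x
    using diff[of 0 x] by (simp add: DERIV_deriv_iff_real_differentiable)
  have c: "continuous_on UNIV \<phi>" "continuous_on UNIV (deriv \<phi>)"
    using differentiable_imp_continuous_within[OF diff[of 0]] differentiable_imp_continuous_within[OF diff[of 1]]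
    by (auto simp: continuous_on_eq_continuous_at)
  have z: "deriv \<phi> x = 0" if "x \<notin> K" for x
  proof -
    have "((\<lambda>x. 0) has_real_derivative 0) (at x)" by simp
    then have "(\<phi> has_real_derivative 0) (at x)"
      by (rule has_field_derivative_transform_within_open[of _ _ _ "- K"])
        (use that zK compact_imp_closed[OF K(1)] in auto)
    then show ?thesis by (rule DERIV_imp_deriv)
  qed
  have bd: "\<exists>C. \<forall>x. \<bar>f x\<bar> \<le> C" if "continuous_on UNIV f" "\<And>x. x \<notin> K \<Longrightarrow> f x = 0" for f :: "real \<Rightarrow> real"
  proof -
    have "compact (f ` K)" by (rule compact_continuous_image[OF continuous_on_subset[OF that(1)] K(1)]) simp
    then obtain C where "\<And>x. x \<in> K \<Longrightarrow> \<bar>f x\<bar> \<le> C"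
      using compact_imp_bounded[of "f ` K"] unfolding bounded_iff by auto
    \<comment> \<open>The 0 serves the points outside \<open>K\<close>, also when \<open>K\<close>
      is empty and \<open>C\<close> is negative.\<close>
    then have "\<bar>f x\<bar> \<le> max C 0" for x
      using that(2)[of x] by (cases "x \<in> K") (auto simp: le_max_iff_disj)
    then show ?thesis by (intro exI allI)
  qed
  obtain C1 C2 where "\<And>x. \<bar>\<phi> x\<bar> \<le> C1" "\<And>x. \<bar>deriv \<phi> x\<bar> \<le> C2"
    using bd[OF c(1) zK] bd[OF c(2) z] by blast
  then have C: "\<And>x. \<bar>\<phi> x\<bar> \<le> max C1 C2" "\<And>x. \<bar>deriv \<phi> x\<bar> \<le> max C1 C2"
    by (simp_all add: le_max_iff_disj)
  show ?thesis by (rule that[OF K zK z C d c])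
qed

lemma set_integrable_mult_test_function:
  assumes "locally_integrable \<Omega> u" "test_function \<Omega> \<phi>"
  shows "set_integrable lebesgue \<Omega> (\<lambda>x. u x * \<phi> x)" "set_integrable lebesgue \<Omega> (\<lambda>x. u x * deriv \<phi> x)"
proof -
  obtain K C where K: "compact K" "K \<subseteq> \<Omega>"
    and "\<And>x. x \<notin> K \<Longrightarrow> \<phi> x = 0" "\<And>x. x \<notin> K \<Longrightarrow> deriv \<phi> x = 0" "\<And>x. \<bar>\<phi> x\<bar> \<le> C" "\<And>x. \<bar>deriv \<phi> x\<bar> \<le> C"
    "\<And>x. (\<phi> has_real_derivative deriv \<phi> x) (at x)" "continuous_on UNIV \<phi>" "continuous_on UNIV (deriv \<phi>)"
    by (rule test_functionD[OF assms(2)]) (rule that)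
  then show "set_integrable lebesgue \<Omega> (\<lambda>x. u x * \<phi> x)" "set_integrable lebesgue \<Omega> (\<lambda>x. u x * deriv \<phi> x)"
    by (auto intro!: set_integrable_mult_compact_support(1)[OF assms(1) K] borel_measurable_continuous_onI)
qed

text \<open>The bumps are test functions, so the difference of two weak derivatives integrates to
  zero against each of them.\<close>

lemma has_weak_derivative_unique:
  assumes "open \<Omega>" and f: "has_weak_derivative \<Omega> u f" and g: "has_weak_derivative \<Omega> u g"
  shows "AE x in lebesgue. x \<in> \<Omega> \<longrightarrow> f x = g x"
proof -
  have l: "locally_integrable \<Omega> f" "locally_integrable \<Omega> g"
    using f g by (auto simp: has_weak_derivative_def)
  have "AE x in lebesgue. x \<in> \<Omega> \<longrightarrow> f x - g x = 0"
  proof (rule AE_eq_0_of_bump_integrals[OF \<open>open \<Omega>\<close> locally_integrable_diff[OF l]])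
    fix t c d :: real
    assume "0 < t" "{c..d} \<subseteq> \<Omega>"
    then have T: "test_function \<Omega> (bump t c d)" by (rule test_function_bump)
    have "(LINT x:\<Omega>|lebesgue. f x * bump t c d x) = (LINT x:\<Omega>|lebesgue. g x * bump t c d x)"
      using f g T unfolding has_weak_derivative_def by fastforce
    then show "(LINT x:\<Omega>|lebesgue. (f x - g x) * bump t c d x) = 0"
      using set_integral_diff(2)[OF set_integrable_mult_test_function(1)[OF l(1) T] set_integrable_mult_test_function(1)[OF l(2) T]]
      by (simp add: left_diff_distrib)
  qed
  then show ?thesis by simp
qed

text \<open>This allows any explicitly known weak derivative to stand in for the choice made by
  \<open>SOME\<close> inside \<open>J\<close>.\<close>

lemma weak_deriv_AE_eq:
  assumes "open \<Omega>" "has_weak_derivative \<Omega> u g"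
  shows "AE x in lebesgue. x \<in> \<Omega> \<longrightarrow> weak_deriv \<Omega> u x = g x"
  using has_weak_derivative_unique[OF assms(1) _ assms(2)] someI[of "has_weak_derivative \<Omega> u", OF assms(2)]
  by (simp add: weak_deriv_def)

lemma has_weak_derivative_diff:
  assumes "has_weak_derivative \<Omega> u f" "has_weak_derivative \<Omega> v g"
  shows "has_weak_derivative \<Omega> (\<lambda>x. u x - v x) (\<lambda>x. f x - g x)"
  unfolding has_weak_derivative_def
proof (intro conjI allI impI)
  have l: "locally_integrable \<Omega> u" "locally_integrable \<Omega> v" "locally_integrable \<Omega> f" "locally_integrable \<Omega> g"
    using assms by (auto simp: has_weak_derivative_def)
  then show "locally_integrable \<Omega> (\<lambda>x. u x - v x)" "locally_integrable \<Omega> (\<lambda>x. f x - g x)"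
    by (auto intro: locally_integrable_diff)
  fix \<phi> assume T: "test_function \<Omega> \<phi>"
  then have "(LINT x:\<Omega>|lebesgue. u x * deriv \<phi> x) = - (LINT x:\<Omega>|lebesgue. f x * \<phi> x)"
    "(LINT x:\<Omega>|lebesgue. v x * deriv \<phi> x) = - (LINT x:\<Omega>|lebesgue. g x * \<phi> x)"
    using assms by (auto simp: has_weak_derivative_def)
  then show "(LINT x:\<Omega>|lebesgue. (u x - v x) * deriv \<phi> x) = - (LINT x:\<Omega>|lebesgue. (f x - g x) * \<phi> x)"
    using T l by (simp add: left_diff_distrib set_integral_diff(2) set_integrable_mult_test_function)
qed

section \<open>Weak derivatives of piecewise differentiable functions\<close>

lemma locally_integrable_boundedI:
  assumes u: "u \<in> borel_measurable borel"
    and bd: "\<And>K. compact K \<Longrightarrow> K \<subseteq> \<Omega> \<Longrightarrow> \<exists>C. \<forall>x\<in>K. \<bar>u x\<bar> \<le> C"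
  shows "locally_integrable \<Omega> u"
  unfolding locally_integrable_def
proof (intro allI impI, elim conjE)
  fix K :: "real set" assume K: "compact K" "K \<subseteq> \<Omega>"
  from bd[OF this] obtain C where C: "\<And>x. x \<in> K \<Longrightarrow> \<bar>u x\<bar> \<le> C" by blast
  note [measurable] = u borel_compact[OF K(1)]
  have "integrable lborel (\<lambda>x. indicator K x *\<^sub>R u x)"
  proof (rule integrableI_bounded_set[of K])
    show "emeasure lborel K < \<infinity>" using emeasure_compact_finite[OF K(1)] .
    show "AE x in lborel. x \<in> K \<longrightarrow> norm (indicator K x *\<^sub>R u x) \<le> C" using C by auto
  qed auto
  then show "set_integrable lebesgue K u"
    unfolding set_integrable_def by (subst integrable_completion) auto
qed

lemma locally_integrable_continuous:
  assumes "continuous_on \<Omega> u"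
  shows "locally_integrable \<Omega> u"
  unfolding locally_integrable_def
proof (intro allI impI, elim conjE)
  fix K :: "real set" assume K: "compact K" "K \<subseteq> \<Omega>"
  have i: "integrable lborel (\<lambda>x. indicator K x *\<^sub>R u x)"
    using borel_integrable_compact[OF K(1) continuous_on_subset[OF assms K(2)]]
    by (simp add: indicator_scaleR_eq_if)
  then show "set_integrable lebesgue K u"
    unfolding set_integrable_def
    using borel_measurable_integrable[OF i] by (subst integrable_completion) simp_all
qed

text \<open>Integration by parts on a compact interval around the support of the test function;
  continuity of \<open>u\<close> makes the exceptional points harmless. Finiteness is asked for on
  compact subintervals only, because the kinks of the oscillating competitors accumulate at the
  origin.\<close>

lemma has_weak_derivativeI_piecewise:
  assumes cont: "continuous_on {a<..<b} u" and g: "locally_integrable {a<..<b} g"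
    and der: "\<And>c d. {c..d} \<subseteq> {a<..<b} \<Longrightarrow>
      \<exists>S. finite S \<and> (\<forall>x\<in>{c<..<d} - S. (u has_real_derivative g x) (at x))"
  shows "has_weak_derivative {a<..<b} u g"
  unfolding has_weak_derivative_def
proof (intro conjI allI impI)
  show u: "locally_integrable {a<..<b} u" using cont by (rule locally_integrable_continuous)
  show "locally_integrable {a<..<b} g" by fact
  fix \<phi> assume T: "test_function {a<..<b} \<phi>"
  obtain K C where K: "compact K" "K \<subseteq> {a<..<b}"
    and z: "\<And>x. x \<notin> K \<Longrightarrow> \<phi> x = 0" "\<And>x. x \<notin> K \<Longrightarrow> deriv \<phi> x = 0"
    and C: "\<And>x. \<bar>\<phi> x\<bar> \<le> C" "\<And>x. \<bar>deriv \<phi> x\<bar> \<le> C"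
    and d\<phi>: "\<And>x. (\<phi> has_real_derivative deriv \<phi> x) (at x)"
    and c\<phi>: "continuous_on UNIV \<phi>" "continuous_on UNIV (deriv \<phi>)"
    by (rule test_functionD[OF T]) (rule that)
  show "(LINT x:{a<..<b}|lebesgue. u x * deriv \<phi> x) = - (LINT x:{a<..<b}|lebesgue. g x * \<phi> x)"
  proof (cases "K = {}")
    case True
    then show ?thesis using z by simp
  next
    case False
    obtain m M where m: "m \<in> K" "\<And>x. x \<in> K \<Longrightarrow> m \<le> x" and M: "M \<in> K" "\<And>x. x \<in> K \<Longrightarrow> x \<le> M"
      using compact_attains_inf[OF K(1) False] compact_attains_sup[OF K(1) False] by metis
    \<comment> \<open>Midpoints between the support and the ends of (a,b): [c,d] is still inside
      (a,b), and \<open>\<phi>\<close> vanishes at both \<open>c\<close> and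
      \<open>d\<close>.\<close>
    define c d where "c = (a + m) / 2" and "d = (M + b) / 2"
    have cd: "a < c" "c < m" "m \<le> M" "M < d" "d < b"
      using m M K(2) by (auto simp: c_def d_def subset_iff)
    have sub: "{c..d} \<subseteq> {a<..<b}" using cd by auto
    have out: "x \<notin> K" if "x \<le> c \<or> x \<ge> d" for x using that cd m(2)[of x] M(2)[of x] by force
    then have z': "x \<notin> {c..d} \<Longrightarrow> \<phi> x = 0" "x \<notin> {c..d} \<Longrightarrow> deriv \<phi> x = 0" for x
      using z by auto
    have b\<phi>: "\<phi> \<in> borel_measurable borel" "deriv \<phi> \<in> borel_measurable borel"
      using c\<phi> by (auto intro: borel_measurable_continuous_onI)
    note R = set_integrable_mult_compact_support(2)[OF _ compact_Icc sub]
    have e: "(LINT x:{a<..<b}|lebesgue. u x * deriv \<phi> x) = (LINT x:{c..d}|lebesgue. u x * deriv \<phi> x)"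
      "(LINT x:{a<..<b}|lebesgue. g x * \<phi> x) = (LINT x:{c..d}|lebesgue. g x * \<phi> x)"
      by (rule R[OF u b\<phi>(2) C(2) z'(2)] R[OF g b\<phi>(1) C(1) z'(1)]; assumption)+
    have i: "set_integrable lebesgue {c..d} (\<lambda>x. u x * deriv \<phi> x)"
      "set_integrable lebesgue {c..d} (\<lambda>x. g x * \<phi> x)"
      using set_integrable_subset[OF set_integrable_mult_test_function(2)[OF u T] _ sub]
        set_integrable_subset[OF set_integrable_mult_test_function(1)[OF g T] _ sub] by auto
    obtain S where S: "finite S" "\<And>x. x \<in> {c<..<d} - S \<Longrightarrow> (u has_real_derivative g x) (at x)"
      using der[OF sub] by blast
    \<comment> \<open>The integrand is the derivative of \<open>u x * \<phi> x\<close>; the boundary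
      terms disappear in the next step.\<close>
    have "((\<lambda>x. u x * deriv \<phi> x + g x * \<phi> x) has_integral (u d * \<phi> d - u c * \<phi> c)) {c..d}"
    proof (rule fundamental_theorem_of_calculus_interior_strong[OF S(1)])
      show "c \<le> d" using cd by simp
      show "continuous_on {c..d} (\<lambda>x. u x * \<phi> x)"
        by (intro continuous_on_mult continuous_on_subset[OF cont sub] continuous_on_subset[OF c\<phi>(1)]) simp
      fix x assume "x \<in> {c<..<d} - S"
      from DERIV_mult[OF S(2)[OF this] d\<phi>[of x]]
      show "((\<lambda>x. u x * \<phi> x) has_vector_derivative u x * deriv \<phi> x + g x * \<phi> x) (at x)"
        by (simp add: has_real_derivative_iff_has_vector_derivative algebra_simps)
    qed
    then have "integral {c..d} (\<lambda>x. u x * deriv \<phi> x + g x * \<phi> x) = 0"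
      using z(1)[OF out, of c] z(1)[OF out, of d] by (simp add: integral_unique)
    then have "(LINT x:{c..d}|lebesgue. u x * deriv \<phi> x + g x * \<phi> x) = 0"
      using set_lebesgue_integral_eq_integral(2)[OF set_integral_add(1)[OF i]] by simp
    then show ?thesis using e set_integral_add(2)[OF i] by simp
  qed
qed

section \<open>Essential bounds and upper estimates for the functional\<close>

lemma Linf_norm_le:
  assumes f: "f \<in> borel_measurable (lebesgue_on \<Omega>)" and "\<Omega> \<in> sets lebesgue"
    and "AE x in lebesgue. x \<in> \<Omega> \<longrightarrow> \<bar>f x\<bar> \<le> C"
  shows "Linf_norm \<Omega> f \<le> ennreal C"
  unfolding Linf_norm_def
proof (rule esssup_I)
  show "(\<lambda>x. ennreal \<bar>f x\<bar>) \<in> borel_measurable (lebesgue_on \<Omega>)" using f by measurable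
  show "AE x in lebesgue_on \<Omega>. ennreal \<bar>f x\<bar> \<le> ennreal C"
    using assms by (subst AE_restrict_space_iff) (auto elim!: eventually_mono intro: ennreal_leI)
qed

lemma LinfI:
  assumes f: "f \<in> borel_measurable (lebesgue_on \<Omega>)" and "\<Omega> \<in> sets lebesgue"
    and "\<And>x. x \<in> \<Omega> \<Longrightarrow> \<bar>f x\<bar> \<le> C"
  shows "f \<in> Linf \<Omega>"
  using Linf_norm_le[OF f, of C] assms by (auto simp: Linf_def intro: order.strict_trans1)

text \<open>The chosen representative is known only almost everywhere, and completeness of Lebesgue
  measure carries measurability over from \<open>g\<close>. This matters because the essential
  supremum of a nonmeasurable function is infinite by convention.\<close>

lemma weak_deriv_measurable:
  assumes "open \<Omega>" and wd: "has_weak_derivative \<Omega> u g" and g: "g \<in> borel_measurable borel"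
  shows "weak_deriv \<Omega> u \<in> borel_measurable (lebesgue_on \<Omega>)"
proof -
  have [measurable]: "\<Omega> \<in> sets borel" using assms by auto
  note g [measurable]
  have "(\<lambda>x. indicator \<Omega> x * weak_deriv \<Omega> u x) \<in> borel_measurable lebesgue"
  proof (rule borel_measurable_AE)
    show "(\<lambda>x. indicator \<Omega> x * g x) \<in> borel_measurable lebesgue"
      by (rule measurable_completion) measurable
    show "AE x in lebesgue. indicator \<Omega> x * g x = indicator \<Omega> x * weak_deriv \<Omega> u x"
      using weak_deriv_AE_eq[OF assms(1) wd] by eventually_elim (auto split: split_indicator)
  qed
  from measurable_restrict_space1[OF this, of \<Omega>] show ?thesis
    by (rule measurable_cong[THEN iffD1, rotated]) (auto simp: space_restrict_space)
qed

text \<open>The interval has length 1, so a uniform bound on the integrand also bounds the integral;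
  in the second summand \<open>g\<close> replaces \<open>weak_deriv\<close> up to a null
  set.\<close>

lemma J_le:
  assumes wd: "has_weak_derivative {0<..<1} u g" and g: "g \<in> borel_measurable borel"
    and D: "\<And>x. 0 < x \<Longrightarrow> x < 1 \<Longrightarrow> (u x)\<^sup>2 / x ^ 3 \<le> D"
    and C: "\<And>x. 0 < x \<Longrightarrow> x < 1 \<Longrightarrow> \<bar>\<bar>g x\<bar> - 1\<bar> \<le> C"
  shows "J u \<le> ennreal D + ennreal C"
  unfolding J_def
proof (rule add_mono)
  have "(\<integral>\<^sup>+x\<in>{0<..<1}. ennreal ((u x)\<^sup>2 / x ^ 3) \<partial>lebesgue) \<le> (\<integral>\<^sup>+x\<in>{0<..<1::real}. ennreal D \<partial>lebesgue)"
    by (rule nn_integral_mono) (use D in \<open>auto split: split_indicator intro: ennreal_leI\<close>)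
  also have "\<dots> = ennreal D" by (simp add: nn_integral_cmult_indicator)
  finally show "(\<integral>\<^sup>+x\<in>{0<..<1}. ennreal ((u x)\<^sup>2 / x ^ 3) \<partial>lebesgue) \<le> ennreal D" .
  note [measurable] = weak_deriv_measurable[OF _ wd g, simplified]
  show "Linf_norm {0<..<1} (\<lambda>x. \<bar>weak_deriv {0<..<1} u x\<bar> - 1) \<le> ennreal C"
  proof (rule Linf_norm_le)
    have "AE x in lebesgue. x \<in> {0<..<1} \<longrightarrow> weak_deriv {0<..<1} u x = g x"
      by (rule weak_deriv_AE_eq[OF _ wd]) simp
    then show "AE x in lebesgue. x \<in> {0<..<1} \<longrightarrow> \<bar>\<bar>weak_deriv {0<..<1} u x\<bar> - 1\<bar> \<le> C"
      using C by (auto elim!: eventually_mono)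
    show "{0<..<1::real} \<in> sets lebesgue" by simp
  qed measurable
qed

section \<open>Oscillating competitors\<close>

text \<open>Composing \<open>arcsin\<close> with \<open>sin\<close> gives the 2 pi periodic zigzag
  with slopes 1 and -1 and values between -pi/2 and pi/2.\<close>

definition triangle_wave :: "real \<Rightarrow> real" where
  "triangle_wave t = arcsin (sin t)"

text \<open>At the corners, where the cosine vanishes, the value 1 is a convention that keeps the
  modulus equal to 1 everywhere.\<close>

definition triangle_slope :: "real \<Rightarrow> real" where
  "triangle_slope t = (if 0 \<le> cos t then 1 else - 1)"

text \<open>Away from the corners the sine lies strictly between -1 and 1, and the chain rule gives
  cos t / |cos t|.\<close>

lemma triangle_wave_has_derivative:
  assumes "cos t \<noteq> 0"
  shows "(triangle_wave has_real_derivative triangle_slope t) (at t)"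
proof -
  have "\<bar>sin t\<bar> < 1"
    using assms sin_cos_squared_add[of t] zero_less_power2[of "cos t"]
    unfolding abs_square_less_1[symmetric] by linarith
  then have s: "-1 < sin t" "sin t < 1" by auto
  have c: "sqrt (1 - (sin t)\<^sup>2) = \<bar>cos t\<bar>"
    by (metis cos_squared_eq real_sqrt_abs)
  have "(triangle_wave has_real_derivative inverse (sqrt (1 - (sin t)\<^sup>2)) * cos t) (at t)"
    unfolding triangle_wave_def[abs_def]
    by (rule DERIV_chain2[OF DERIV_arcsin[OF s] DERIV_sin])
  then show ?thesis
    using assms by (auto simp: c triangle_slope_def abs_if split: if_splits elim!: DERIV_cong)
qed

lemma continuous_triangle_wave: "continuous_on UNIV triangle_wave"
  unfolding triangle_wave_def[abs_def] by (intro continuous_on_arcsin continuous_intros) auto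

lemma triangle_wave_measurable [measurable]: "triangle_wave \<in> borel_measurable borel"
  using continuous_triangle_wave by (rule borel_measurable_continuous_onI)

lemma triangle_slope_measurable [measurable]: "triangle_slope \<in> borel_measurable borel"
  unfolding triangle_slope_def[abs_def] by measurable

lemma abs_triangle_wave_le: "\<bar>triangle_wave t\<bar> \<le> 2"
  using arcsin_bounded[of "sin t"] pi_less_4 by (auto simp: triangle_wave_def abs_le_iff)

text \<open>The amplitude \<open>\<epsilon> * x\<^sup>2\<close> cancels the inner derivative of
  \<open>1 / (\<epsilon> * x)\<close>, leaving a slope of modulus 1 plus an error of at most
  \<open>4 * \<epsilon>\<close> from differentiating the amplitude. The quadratic decay also gives
  \<open>(u x)\<^sup>2 / x ^ 3 \<le> 4 * \<epsilon>\<^sup>2 * x\<close>.\<close>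

lemma ex_J_le:
  assumes \<epsilon>: "0 < \<epsilon>"
  shows "\<exists>u \<in> W1_inf {0<..<1}. J u \<le> ennreal (4 * \<epsilon>\<^sup>2) + ennreal (4 * \<epsilon>)"
proof -
  define u where "u x = \<epsilon> * x\<^sup>2 * triangle_wave (1 / (\<epsilon> * x))" for x
  define g where "g x = 2 * \<epsilon> * x * triangle_wave (1 / (\<epsilon> * x)) - triangle_slope (1 / (\<epsilon> * x))" for x
  have [measurable]: "u \<in> borel_measurable borel" "g \<in> borel_measurable borel"
    unfolding u_def[abs_def] g_def[abs_def] by measurable
  have ub: "\<bar>u x\<bar> \<le> 2 * \<epsilon> * x\<^sup>2" for x
    using mult_left_mono[OF abs_triangle_wave_le[of "1 / (\<epsilon> * x)"], of "\<epsilon> * x\<^sup>2"] \<epsilon>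
    by (simp add: u_def abs_mult mult.commute)
  have gb: "\<bar>2 * \<epsilon> * x * triangle_wave (1 / (\<epsilon> * x))\<bar> \<le> 4 * \<epsilon>" if "0 < x" "x < 1" for x
  proof -
    have "\<bar>x * triangle_wave (1 / (\<epsilon> * x))\<bar> \<le> 1 * 2"
      unfolding abs_mult by (rule mult_mono[OF _ abs_triangle_wave_le]) (use that in auto)
    then have "2 * \<epsilon> * \<bar>x * triangle_wave (1 / (\<epsilon> * x))\<bar> \<le> 2 * \<epsilon> * (1 * 2)"
      using \<epsilon> by (intro mult_left_mono) auto
    then show ?thesis using \<epsilon> by (simp add: abs_mult mult.assoc)
  qed
  have g1: "\<bar>\<bar>g x\<bar> - 1\<bar> \<le> 4 * \<epsilon>" if "0 < x" "x < 1" for x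
    using gb[OF that] by (auto simp: g_def triangle_slope_def)
  have glb: "\<bar>g x\<bar> \<le> 4 * \<epsilon> + 1" if "0 < x" "x < 1" for x using g1[OF that] by linarith
  have wd: "has_weak_derivative {0<..<1} u g"
  proof (rule has_weak_derivativeI_piecewise)
    show "continuous_on {0<..<1} u"
      unfolding u_def using \<epsilon>
      by (intro continuous_intros continuous_on_compose2[OF continuous_triangle_wave]) auto
    show "locally_integrable {0<..<1} g"
      by (rule locally_integrable_boundedI) (use glb in \<open>auto intro!: exI[of _ "4 * \<epsilon> + 1"] dest!: subsetD\<close>)
    fix c d :: real assume sub: "{c..d} \<subseteq> {0<..<1}"
    let ?S = "{x \<in> {c<..<d}. cos (1 / (\<epsilon> * x)) = 0}"
    \<comment> \<open>Kinks occur only where \<open>1 / (\<epsilon> * x)\<close> is an integer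
      multiple i of pi/2. Since x > c and pi/2 is at least 1, i is at most
      \<open>1 / (\<epsilon> * c)\<close>, which leaves finitely many.\<close>
    have "finite ?S"
    proof (cases "c \<le> d")
      case True
      then have c: "0 < c" using sub by auto
      have "?S \<subseteq> (\<lambda>i::int. 1 / (\<epsilon> * (real_of_int i * (pi / 2)))) ` {0..\<lceil>1 / (\<epsilon> * c)\<rceil>}"
      proof
        fix x assume "x \<in> ?S"
        then have x: "c < x" and "cos (1 / (\<epsilon> * x)) = 0" by auto
        then obtain i :: int where i: "1 / (\<epsilon> * x) = real_of_int i * (pi / 2)"
          unfolding cos_zero_iff_int by blast
        have xpos: "0 < x" using x c by simp
        have pos: "0 < real_of_int i * (pi / 2)" unfolding i[symmetric] using \<epsilon> xpos by simp
        then have i0: "0 < i" by (simp add: zero_less_mult_iff)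
        have "real_of_int i * 1 \<le> real_of_int i * (pi / 2)"
          using i0 pi_ge_two by (intro mult_left_mono) auto
        also have "\<dots> \<le> 1 / (\<epsilon> * c)" unfolding i[symmetric] using \<epsilon> x c by (simp add: frac_le)
        finally have "i \<le> \<lceil>1 / (\<epsilon> * c)\<rceil>" by linarith
        moreover have "x = 1 / (\<epsilon> * (real_of_int i * (pi / 2)))"
          unfolding i[symmetric] using \<epsilon> xpos by simp
        ultimately show "x \<in> (\<lambda>i::int. 1 / (\<epsilon> * (real_of_int i * (pi / 2)))) ` {0..\<lceil>1 / (\<epsilon> * c)\<rceil>}"
          using i0 by auto
      qed
      then show ?thesis by (rule finite_subset) simp
    qed auto
    moreover have "(u has_real_derivative g x) (at x)" if "x \<in> {c<..<d} - ?S" for x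
    proof -
      have x: "0 < x" and nz: "cos (1 / (\<epsilon> * x)) \<noteq> 0" using that sub by (auto simp: subset_iff)
      have i: "((\<lambda>x. 1 / (\<epsilon> * x)) has_real_derivative - (1 / (\<epsilon> * x\<^sup>2))) (at x)"
        using x \<epsilon> by (auto intro!: derivative_eq_intros simp: field_simps power2_eq_square)
      note d = DERIV_chain2[OF triangle_wave_has_derivative[OF nz] i]
      have s: "((\<lambda>x. \<epsilon> * x\<^sup>2) has_real_derivative 2 * \<epsilon> * x) (at x)"
        by (auto intro!: derivative_eq_intros)
      from DERIV_mult[OF s d] show ?thesis
        unfolding u_def[abs_def]
        by (rule DERIV_cong) (use x \<epsilon> in \<open>simp add: g_def field_simps power2_eq_square\<close>)
    qed
    ultimately show "\<exists>S. finite S \<and> (\<forall>x\<in>{c<..<d} - S. (u has_real_derivative g x) (at x))"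
      by (intro exI[of _ ?S]) simp
  qed
  have ml: "u \<in> borel_measurable (lebesgue_on {0<..<1})" "g \<in> borel_measurable (lebesgue_on {0<..<1})"
    by (intro measurable_restrict_space1 measurable_completion; simp)+
  have "u \<in> Linf {0<..<1}"
  proof (rule LinfI[OF ml(1)])
    fix x :: real assume x: "x \<in> {0<..<1}"
    have "2 * \<epsilon> * x\<^sup>2 \<le> 2 * \<epsilon> * 1" using x \<epsilon> by (intro mult_left_mono power_le_one) auto
    then show "\<bar>u x\<bar> \<le> 2 * \<epsilon>" using ub[of x] by simp
  qed simp
  moreover have "g \<in> Linf {0<..<1}" by (rule LinfI[OF ml(2)]) (use glb in auto)
  ultimately have "u \<in> W1_inf {0<..<1}" using wd by (auto simp: W1_inf_def)
  moreover have "J u \<le> ennreal (4 * \<epsilon>\<^sup>2) + ennreal (4 * \<epsilon>)"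
  proof (rule J_le[OF wd _ _ g1])
    fix x :: real assume x: "0 < x" "x < 1"
    have "(u x)\<^sup>2 \<le> (2 * \<epsilon> * x\<^sup>2)\<^sup>2" using ub[of x] by (metis abs_ge_zero power2_abs power_mono)
    also have "\<dots> = (4 * \<epsilon>\<^sup>2 * x) * x ^ 3" by (simp add: power_mult_distrib eval_nat_numeral)
    finally have "(u x)\<^sup>2 / x ^ 3 \<le> 4 * \<epsilon>\<^sup>2 * x" using x by (simp add: field_simps)
    also have "\<dots> \<le> 4 * \<epsilon>\<^sup>2" using x by (simp add: mult_left_le)
    finally show "(u x)\<^sup>2 / x ^ 3 \<le> 4 * \<epsilon>\<^sup>2" .
  qed measurable
  ultimately show ?thesis by blast
qed

section \<open>Finite signed measures\<close>

text \<open>Countable additivity for the sequence A, B, {}, {}, ..., whose tail contributes nothing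
  because \<open>\<nu> {} = 0\<close>.\<close>

lemma finite_signed_measure_Un:
  assumes \<nu>: "finite_signed_measure M \<nu>" and "A \<in> sets M" "B \<in> sets M" "A \<inter> B = {}"
  shows "\<nu> (A \<union> B) = \<nu> A + \<nu> B"
proof -
  have "(\<lambda>i. \<nu> (binaryset A B i)) sums \<nu> (\<Union>i. binaryset A B i)"
  proof -
    have "range (binaryset A B) \<subseteq> sets M" using assms by (simp add: range_binaryset_eq)
    moreover have "disjoint_family (binaryset A B)"
      using assms(4) unfolding disjoint_family_on_def binaryset_def by auto
    ultimately show ?thesis using \<nu> unfolding finite_signed_measure_def by blast
  qed
  moreover have "(\<lambda>i. \<nu> (binaryset A B i)) sums (\<nu> A + \<nu> B)"
    using \<nu> by (intro binaryset_sums) (simp add: finite_signed_measure_def)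
  ultimately show ?thesis by (simp add: UN_binaryset_eq sums_unique2)
qed

lemma finite_signed_measure_bounded:
  assumes \<nu>: "finite_signed_measure M \<nu>"
  shows "\<exists>C. \<forall>A\<in>sets M. \<bar>\<nu> A\<bar> \<le> C"
proof (rule ccontr)
  define bad where "bad E \<longleftrightarrow> E \<in> sets M \<and> (\<forall>C. \<exists>B\<in>sets M. B \<subseteq> E \<and> C < \<bar>\<nu> B\<bar>)" for E
  have badD: "\<exists>B\<in>sets M. B \<subseteq> E \<and> C < \<bar>\<nu> B\<bar>" if "bad E" for E C
    using that by (simp add: bad_def)
  have not_badD: "\<exists>C. \<forall>B\<in>sets M. B \<subseteq> E \<longrightarrow> \<bar>\<nu> B\<bar> \<le> C" if "\<not> bad E" "E \<in> sets M" for E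
    using that by (simp add: bad_def not_less)
  \<comment> \<open>Splitting a set of unbounded variation again and again cuts off disjoint pieces of size \<open>> 1\<close>,
    contradicting summability.\<close>
  assume "\<not> ?thesis"
  then have "\<forall>C. \<exists>A\<in>sets M. C < \<bar>\<nu> A\<bar>" by (simp add: not_le)
  then have bad0: "bad (space M)"
    unfolding bad_def using sets.sets_into_space[of _ M] by fastforce
  have step: "\<exists>B. bad B \<and> B \<subseteq> E \<and> 1 < \<bar>\<nu> (E - B)\<bar>" if bad: "bad E" for E
  proof -
    from bad have E: "E \<in> sets M" by (simp add: bad_def)
    obtain C where C: "C \<in> sets M" "C \<subseteq> E" "1 + \<bar>\<nu> E\<bar> < \<bar>\<nu> C\<bar>"
      using badD[OF bad, of "1 + \<bar>\<nu> E\<bar>"] by blast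
    have "\<nu> E = \<nu> C + \<nu> (E - C)"
      using finite_signed_measure_Un[OF \<nu>, of C "E - C"] E C
      by (simp add: Un_absorb1)
    \<comment> \<open>The value on \<open>C\<close> exceeds that on \<open>E\<close> by more than 1
      in modulus, so the complementary piece must exceed 1 as well. Either piece may thus be cut
      off.\<close>
    with C(3) have big: "1 < \<bar>\<nu> C\<bar>" "1 < \<bar>\<nu> (E - C)\<bar>" by linarith+
    \<comment> \<open>If both pieces had bounded values, \<open>K1 + K2\<close> would bound the
      values on all measurable subsets of \<open>E\<close>.\<close>
    have "bad C \<or> bad (E - C)"
    proof (rule ccontr)
      assume "\<not> (bad C \<or> bad (E - C))"
      then have nb: "\<not> bad C" "\<not> bad (E - C)" by auto
      obtain K1 where K1: "\<forall>B\<in>sets M. B \<subseteq> C \<longrightarrow> \<bar>\<nu> B\<bar> \<le> K1"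
        using not_badD[OF nb(1) C(1)] by (rule exE)
      obtain K2 where K2: "\<forall>B\<in>sets M. B \<subseteq> E - C \<longrightarrow> \<bar>\<nu> B\<bar> \<le> K2"
        using not_badD[OF nb(2) sets.Diff[OF E C(1)]] by (rule exE)
      obtain B where B: "B \<in> sets M" "B \<subseteq> E" "K1 + K2 < \<bar>\<nu> B\<bar>"
        using badD[OF bad, of "K1 + K2"] by blast
      have "\<nu> B = \<nu> (B \<inter> C) + \<nu> (B - C)"
        using finite_signed_measure_Un[OF \<nu>, of "B \<inter> C" "B - C"] B C by (simp add: Int_Diff_Un Int_Diff_disjoint)
      moreover have "\<bar>\<nu> (B \<inter> C)\<bar> \<le> K1" "\<bar>\<nu> (B - C)\<bar> \<le> K2"
        using B(2) K1[rule_format, OF sets.Int[OF B(1) C(1)]] K2[rule_format, OF sets.Diff[OF B(1) C(1)]] by auto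
      ultimately show False using B(3) by linarith
    qed
    then show ?thesis
    proof
      assume "bad C" then show ?thesis using C big by blast
    next
      assume "bad (E - C)" then show ?thesis
        using big double_diff[OF C(2) subset_refl] by (intro exI[of _ "E - C"]) simp
    qed
  qed
  have "\<exists>X. \<forall>n. bad (X n) \<and> X (Suc n) \<subseteq> X n \<and> 1 < \<bar>\<nu> (X n - X (Suc n))\<bar>"
    by (rule dependent_nat_choice[of "\<lambda>_. bad" "\<lambda>_ E B. B \<subseteq> E \<and> 1 < \<bar>\<nu> (E - B)\<bar>"])
      (use bad0 step in blast)+
  then obtain X where X: "\<And>n. bad (X n)" "\<And>n. X (Suc n) \<subseteq> X n" "\<And>n. 1 < \<bar>\<nu> (X n - X (Suc n))\<bar>"
    by blast
  have dec: "decseq X" using X(2) by (rule decseq_SucI)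
  let ?A = "\<lambda>n. X n - X (Suc n)"
  have lt: "?A m \<inter> ?A n = {}" if "m < n" for m n
    using decseqD[OF dec, of "Suc m" n] that by auto
  have "disjoint_family ?A"
    unfolding disjoint_family_on_def using lt by (metis Int_commute linorder_neqE_nat)
  moreover have "range ?A \<subseteq> sets M" using X(1) by (auto simp: bad_def)
  ultimately have "(\<lambda>i. \<nu> (?A i)) sums \<nu> (\<Union>i. ?A i)"
    using \<nu> unfolding finite_signed_measure_def by blast
  then have "(\<lambda>i. \<nu> (?A i)) \<longlonglongrightarrow> 0" by (intro summable_LIMSEQ_zero sums_summable)
  then have "\<forall>\<^sub>F n in sequentially. \<bar>\<nu> (?A n)\<bar> < 1"
    using order_tendstoD(2)[OF tendsto_rabs_zero, of _ sequentially 1] by simp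
  then show False using X(3) by (auto simp: eventually_sequentially dest: less_asym)
qed

lemma sets_positive_variation [simp]: "sets (positive_variation M \<nu>) = sets M"
  by (simp add: positive_variation_def sets_measure_of[OF sets.space_closed] sets.sigma_sets_eq)

lemma sets_negative_variation [simp]: "sets (negative_variation M \<nu>) = sets M"
  by (simp add: negative_variation_def)

text \<open>If the supremum defining the positive variation were not countably additive,
  \<^const>\<open>measure_of\<close> would yield the zero measure, so only boundedness is needed.\<close>

lemma finite_measure_positive_variation:
  assumes "finite_signed_measure M \<nu>"
  shows "finite_measure (positive_variation M \<nu>)"
proof (rule finite_measureI)
  obtain C where C: "\<And>A. A \<in> sets M \<Longrightarrow> \<bar>\<nu> A\<bar> \<le> C"
    using finite_signed_measure_bounded[OF assms] by blast
  have "(SUP B \<in> {B \<in> sets M. B \<subseteq> space M}. ennreal (\<nu> B)) \<le> ennreal C"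
    using C by (auto intro!: SUP_least ennreal_leI dest: abs_le_D1)
  then have "emeasure (positive_variation M \<nu>) (space M) \<le> ennreal C"
    unfolding positive_variation_def emeasure_measure_of_conv by auto
  then show "emeasure (positive_variation M \<nu>) (space (positive_variation M \<nu>)) \<noteq> \<infinity>"
    using sets_eq_imp_space_eq[OF sets_positive_variation[of M \<nu>]] by (auto simp: top_unique)
qed

lemma finite_measure_negative_variation:
  assumes "finite_signed_measure M \<nu>"
  shows "finite_measure (negative_variation M \<nu>)"
proof -
  have "finite_signed_measure M (\<lambda>A. - \<nu> A)"
    using assms by (auto simp: finite_signed_measure_def intro: sums_minus)
  then show ?thesis
    unfolding negative_variation_def by (rule finite_measure_positive_variation)
qed

section \<open>One-sided derivatives of Barron functions\<close>

text \<open>Fubini moves the defining identity under the integral over \<open>Q\<close>. The bounds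
  uniform in \<open>w\<close> make the integrand bounded on the product of the support with
  \<open>space Q\<close>, a set of finite measure.\<close>

lemma has_weak_derivative_integral:
  fixes h k :: "real \<Rightarrow> 'w \<Rightarrow> real"
  assumes "finite_measure Q" and "open \<Omega>"
    and h [measurable]: "case_prod h \<in> borel_measurable (lborel \<Otimes>\<^sub>M Q)"
    and k [measurable]: "case_prod k \<in> borel_measurable (lborel \<Otimes>\<^sub>M Q)"
    and bd: "\<And>K. compact K \<Longrightarrow> K \<subseteq> \<Omega> \<Longrightarrow> \<exists>C. \<forall>x\<in>K. \<forall>w\<in>space Q. \<bar>h x w\<bar> \<le> C \<and> \<bar>k x w\<bar> \<le> C"
    and wd: "\<And>w. w \<in> space Q \<Longrightarrow> has_weak_derivative \<Omega> (\<lambda>x. h x w) (\<lambda>x. k x w)"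
  shows "has_weak_derivative \<Omega> (\<lambda>x. LINT w|Q. h x w) (\<lambda>x. LINT w|Q. k x w)"
proof -
  interpret Q: finite_measure Q by fact
  interpret pair_sigma_finite lborel Q ..
  have [measurable]: "\<Omega> \<in> sets borel" using \<open>open \<Omega>\<close> by auto
  have hm [measurable]: "(\<lambda>x. LINT w|Q. h x w) \<in> borel_measurable borel" "(\<lambda>x. LINT w|Q. k x w) \<in> borel_measurable borel"
    using Q.borel_measurable_lebesgue_integral[OF h] Q.borel_measurable_lebesgue_integral[OF k] by simp_all
  \<comment> \<open>A nonintegrable function has integral 0 by convention, so the bound holds in
    that case too; \<open>\<bar>C\<bar>\<close> keeps the right-hand side nonnegative.\<close>
  have int_le: "\<bar>LINT w|Q. f w\<bar> \<le> \<bar>C\<bar> * measure Q (space Q)" if "\<forall>w\<in>space Q. \<bar>f w\<bar> \<le> C" for f C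
  proof (cases "integrable Q f")
    case True
    have "\<bar>LINT w|Q. f w\<bar> \<le> (LINT w|Q. \<bar>C\<bar>)"
    proof (rule order_trans[OF integral_abs_bound integral_mono])
      show "\<bar>f w\<bar> \<le> \<bar>C\<bar>" if "w \<in> space Q" for w using \<open>\<forall>w\<in>space Q. \<bar>f w\<bar> \<le> C\<close> that by force
    qed (use True in auto)
    then show ?thesis by (simp add: mult.commute)
  qed (simp add: not_integrable_integral_eq)
  have li: "locally_integrable \<Omega> (\<lambda>x. LINT w|Q. h x w)" "locally_integrable \<Omega> (\<lambda>x. LINT w|Q. k x w)"
  proof -
    have "(\<exists>C. \<forall>x\<in>K. \<bar>LINT w|Q. h x w\<bar> \<le> C) \<and> (\<exists>C. \<forall>x\<in>K. \<bar>LINT w|Q. k x w\<bar> \<le> C)"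
      if "compact K" "K \<subseteq> \<Omega>" for K
    proof -
      obtain C where "\<forall>x\<in>K. \<forall>w\<in>space Q. \<bar>h x w\<bar> \<le> C \<and> \<bar>k x w\<bar> \<le> C" using bd \<open>compact K\<close> \<open>K \<subseteq> \<Omega>\<close> by blast
      then show ?thesis
        by (intro conjI exI[of _ "\<bar>C\<bar> * measure Q (space Q)"] ballI int_le) auto
    qed
    then show "locally_integrable \<Omega> (\<lambda>x. LINT w|Q. h x w)" "locally_integrable \<Omega> (\<lambda>x. LINT w|Q. k x w)"
      by (intro locally_integrable_boundedI hm; blast)+
  qed
  show ?thesis
    unfolding has_weak_derivative_def
  proof (intro conjI li allI impI)
    fix \<phi> assume T: "test_function \<Omega> \<phi>"
    obtain K C where K: "compact K" "K \<subseteq> \<Omega>"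
      and z: "\<And>x. x \<notin> K \<Longrightarrow> \<phi> x = 0" "\<And>x. x \<notin> K \<Longrightarrow> deriv \<phi> x = 0"
      and C: "\<And>x. \<bar>\<phi> x\<bar> \<le> C" "\<And>x. \<bar>deriv \<phi> x\<bar> \<le> C"
      and "\<And>x. (\<phi> has_real_derivative deriv \<phi> x) (at x)"
      and c\<phi>: "continuous_on UNIV \<phi>" "continuous_on UNIV (deriv \<phi>)"
      by (rule test_functionD[OF T]) (rule that)
    obtain B where B: "\<And>x w. x \<in> K \<Longrightarrow> w \<in> space Q \<Longrightarrow> \<bar>h x w\<bar> \<le> B \<and> \<bar>k x w\<bar> \<le> B"
      using bd[OF K] by blast
    have [measurable]: "\<phi> \<in> borel_measurable borel" "deriv \<phi> \<in> borel_measurable borel"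
      using c\<phi> by (auto intro: borel_measurable_continuous_onI)
    have swap: "(LINT x:\<Omega>|lebesgue. (LINT w|Q. f x w) * \<psi> x) = (LINT w|Q. (LINT x:\<Omega>|lebesgue. f x w * \<psi> x))"
      if f [measurable]: "case_prod f \<in> borel_measurable (lborel \<Otimes>\<^sub>M Q)"
        and \<psi> [measurable]: "\<psi> \<in> borel_measurable borel"
        and fB: "\<And>x w. x \<in> K \<Longrightarrow> w \<in> space Q \<Longrightarrow> \<bar>f x w\<bar> \<le> B"
        and \<psi>C: "\<And>x. \<bar>\<psi> x\<bar> \<le> C" and \<psi>z: "\<And>x. x \<notin> K \<Longrightarrow> \<psi> x = 0" for f \<psi>
    proof -
      have i: "integrable (lborel \<Otimes>\<^sub>M Q) (\<lambda>(x, w). indicator \<Omega> x *\<^sub>R (f x w * \<psi> x))"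
      proof (rule integrableI_bounded_set[of "K \<times> space Q"])
        show "K \<times> space Q \<in> sets (lborel \<Otimes>\<^sub>M Q)"
          using borel_compact[OF K(1)] by (intro pair_measureI) auto
        show "(\<lambda>(x, w). indicator \<Omega> x *\<^sub>R (f x w * \<psi> x)) \<in> borel_measurable (lborel \<Otimes>\<^sub>M Q)"
          by measurable
        show "emeasure (lborel \<Otimes>\<^sub>M Q) (K \<times> space Q) < \<infinity>"
          using borel_compact[OF K(1)] emeasure_compact_finite[OF K(1)]
          by (simp add: Q.emeasure_pair_measure_Times ennreal_mult_eq_top_iff less_top[symmetric])
        have "norm (indicator \<Omega> x *\<^sub>R (f x w * \<psi> x)) \<le> B * C" if "x \<in> K" "w \<in> space Q" for x w
          using mult_mono[OF fB[OF that] \<psi>C[of x]] fB[OF that] subsetD[OF K(2) that(1)] by (auto simp: abs_mult split: split_indicator)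
        then show "AE z in lborel \<Otimes>\<^sub>M Q. z \<in> K \<times> space Q \<longrightarrow> norm ((\<lambda>(x, w). indicator \<Omega> x *\<^sub>R (f x w * \<psi> x)) z) \<le> B * C"
          by auto
        show "AE z in lborel \<Otimes>\<^sub>M Q. z \<notin> K \<times> space Q \<longrightarrow> (\<lambda>(x, w). indicator \<Omega> x *\<^sub>R (f x w * \<psi> x)) z = 0"
          using contrapos_np[OF _ \<psi>z] by (intro AE_I2) (auto simp: space_pair_measure)
      qed
      have fm [measurable]: "f x \<in> borel_measurable Q" "(\<lambda>x. f x w) \<in> borel_measurable borel" if "w \<in> space Q" for x w
        using measurable_Pair2[OF f, of x] measurable_Pair1[OF f that] by simp_all
      \<comment> \<open>The integrands are Borel in \<open>x\<close>, so the integrals can be moved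
        to \<open>lborel\<close>, the factor for which product measurability and Fubini are
        available.\<close>
      have "(LINT x:\<Omega>|lebesgue. (LINT w|Q. f x w) * \<psi> x) = (LINT x:\<Omega>|lborel. (LINT w|Q. f x w) * \<psi> x)"
        unfolding set_lebesgue_integral_def by (rule integral_completion) measurable
      also have "\<dots> = (LINT x|lborel. LINT w|Q. indicator \<Omega> x *\<^sub>R (f x w * \<psi> x))"
        unfolding set_lebesgue_integral_def by simp
      also have "\<dots> = (LINT w|Q. LINT x|lborel. indicator \<Omega> x *\<^sub>R (f x w * \<psi> x))"
        using Fubini_integral[OF i] by simp
      also have "\<dots> = (LINT w|Q. (LINT x:\<Omega>|lebesgue. f x w * \<psi> x))"
        unfolding set_lebesgue_integral_def
      proof (rule Bochner_Integration.integral_cong[OF refl])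
        fix w assume "w \<in> space Q"
        note [measurable] = fm(2)[OF this]
        show "(LINT x|lborel. indicator \<Omega> x *\<^sub>R (f x w * \<psi> x)) = (LINT x|lebesgue. indicator \<Omega> x *\<^sub>R (f x w * \<psi> x))"
          by (rule integral_completion[symmetric]) measurable
      qed
      finally show ?thesis .
    qed
    have "(LINT x:\<Omega>|lebesgue. (LINT w|Q. h x w) * deriv \<phi> x) = (LINT w|Q. (LINT x:\<Omega>|lebesgue. h x w * deriv \<phi> x))"
      using B C z by (intro swap) auto
    also have "\<dots> = (LINT w|Q. - (LINT x:\<Omega>|lebesgue. k x w * \<phi> x))"
      using wd T by (intro Bochner_Integration.integral_cong) (auto simp: has_weak_derivative_def)
    also have "\<dots> = - (LINT x:\<Omega>|lebesgue. (LINT w|Q. k x w) * \<phi> x)"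
      using B C z by (subst swap) auto
    finally show "(LINT x:\<Omega>|lebesgue. (LINT w|Q. h x w) * deriv \<phi> x) = - (LINT x:\<Omega>|lebesgue. (LINT w|Q. k x w) * \<phi> x)" .
  qed
qed

lemma integral_dominated_convergence_at_right:
  fixes s :: "real \<Rightarrow> 'a \<Rightarrow> real"
  assumes "\<And>x. s x \<in> borel_measurable M" "f \<in> borel_measurable M" "integrable M v"
    and "\<And>x w. c < x \<Longrightarrow> w \<in> space M \<Longrightarrow> \<bar>s x w\<bar> \<le> v w"
    and lim: "\<And>w. w \<in> space M \<Longrightarrow> ((\<lambda>x. s x w) \<longlongrightarrow> f w) (at_right c)"
  shows "((\<lambda>x. LINT w|M. s x w) \<longlongrightarrow> (LINT w|M. f w)) (at_right c)"
\<comment> \<open>The endpoint \<open>c + 1\<close> merely fixes a right neighbourhood of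
  \<open>c\<close> for the sequences.\<close>
proof (rule tendsto_at_right_sequentially[of _ "c + 1"])
  fix S :: "nat \<Rightarrow> real" assume S: "\<And>n. c < S n" "S \<longlonglongrightarrow> c"
  then have "filterlim S (at_right c) sequentially"
    by (auto simp: filterlim_at less_imp_neq[symmetric])
  show "(\<lambda>n. LINT w|M. s (S n) w) \<longlonglongrightarrow> (LINT w|M. f w)"
  proof (rule integral_dominated_convergence[where w = v])
    show "AE w in M. (\<lambda>n. s (S n) w) \<longlonglongrightarrow> f w"
      using filterlim_compose[OF lim \<open>filterlim S (at_right c) sequentially\<close>] by auto
  qed (use assms S in auto)
qed simp

section \<open>Single neurons and their slopes at the origin\<close>

definition neuron :: "real \<Rightarrow> real \<times> real \<Rightarrow> real" where
  "neuron x w = relu (w \<bullet> (x, 1))"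

definition neuron_slope :: "real \<Rightarrow> real \<times> real \<Rightarrow> real" where
  "neuron_slope x w = (if 0 < w \<bullet> (x, 1) then fst w else 0)"

text \<open>The right-hand slope at 0. For small x > 0 the sign of \<open>w \<bullet> (x, 1)\<close>
  is that of \<open>snd w\<close>, and that of \<open>fst w\<close> if
  \<open>snd w = 0\<close>.\<close>

definition neuron_slope0 :: "real \<times> real \<Rightarrow> real" where
  "neuron_slope0 w = (if 0 < snd w \<or> snd w = 0 \<and> 0 < fst w then fst w else 0)"

lemma inner_x_1: "w \<bullet> (x, 1) = fst w * x + snd w" for w :: "real \<times> real"
  by (cases w) simp

text \<open>Guarantees that p x + q has the sign of q just to the right of 0.\<close>

lemma eventually_at_right_0_abs_mult_less:
  fixes p q :: real
  assumes "q \<noteq> 0"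
  shows "\<forall>\<^sub>F x in at_right 0. \<bar>p * x\<bar> < \<bar>q\<bar>"
proof -
  have "((\<lambda>x. \<bar>p * x\<bar>) \<longlongrightarrow> \<bar>p * 0\<bar>) (at_right 0)"
    by (intro tendsto_intros)
  then show ?thesis using assms by (intro order_tendstoD(2)) auto
qed

text \<open>The sign of the affine argument is constant just to the right of 0, so the slope equals
  its limit there.\<close>

lemma neuron_slope_tendsto: "((\<lambda>x. neuron_slope x w) \<longlongrightarrow> neuron_slope0 w) (at_right 0)"
proof (rule tendsto_eventually, cases "snd w = 0")
  case True
  show "\<forall>\<^sub>F x in at_right 0. neuron_slope x w = neuron_slope0 w"
    using eventually_at_right_less[of 0]
    by eventually_elim (auto simp: neuron_slope_def neuron_slope0_def inner_x_1 True zero_less_mult_iff)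
next
  case False
  show "\<forall>\<^sub>F x in at_right 0. neuron_slope x w = neuron_slope0 w"
    using eventually_at_right_0_abs_mult_less[OF False, of "fst w"]
    by eventually_elim (use False in \<open>auto simp: neuron_slope_def neuron_slope0_def inner_x_1\<close>)
qed

text \<open>Just to the right of 0 the neuron is affine, up to and including 0, so the quotient
  equals the slope exactly. This ties the one-sided derivative at 0 to the limit of the
  slopes.\<close>

lemma neuron_quotient_tendsto:
  "((\<lambda>x. (neuron x w - neuron 0 w) / x) \<longlongrightarrow> neuron_slope0 w) (at_right 0)"
proof (rule tendsto_eventually, cases "snd w = 0")
  case True
  show "\<forall>\<^sub>F x in at_right 0. (neuron x w - neuron 0 w) / x = neuron_slope0 w"
    using eventually_at_right_less[of 0]
    by eventually_elim
      (auto simp: neuron_def relu_def neuron_slope0_def inner_x_1 True max_def mult_le_0_iff)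
next
  case False
  show "\<forall>\<^sub>F x in at_right 0. (neuron x w - neuron 0 w) / x = neuron_slope0 w"
    using eventually_at_right_less[of 0] eventually_at_right_0_abs_mult_less[OF False, of "fst w"]
    by eventually_elim
      (use False in \<open>auto simp: neuron_def relu_def neuron_slope0_def inner_x_1 max_def\<close>)
qed

lemma neuron_has_weak_derivative:
  "has_weak_derivative {a<..<b} (\<lambda>x. neuron x w) (\<lambda>x. neuron_slope x w)"
proof (rule has_weak_derivativeI_piecewise)
  show "continuous_on {a<..<b} (\<lambda>x. neuron x w)"
    unfolding neuron_def relu_def inner_x_1 by (intro continuous_intros)
  show "locally_integrable {a<..<b} (\<lambda>x. neuron_slope x w)"
  proof (rule locally_integrable_boundedI)
    show "(\<lambda>x. neuron_slope x w) \<in> borel_measurable borel"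
      unfolding neuron_slope_def inner_x_1 by measurable
  qed (auto simp: neuron_slope_def intro!: exI[of _ "\<bar>fst w\<bar>"])
  fix c d
  have "(((\<lambda>x. neuron x w)) has_real_derivative neuron_slope x w) (at x)"
    if nz: "w \<bullet> (x, 1) \<noteq> 0" for x
  proof (cases "0 < w \<bullet> (x, 1)")
    case True
    have "((\<lambda>x. fst w * x + snd w) has_real_derivative fst w) (at x)"
      by (auto intro!: derivative_eq_intros)
    then have "((\<lambda>x. neuron x w) has_real_derivative fst w) (at x)"
    proof (rule has_field_derivative_transform_within_open)
      show "open {x. 0 < fst w * x + snd w}" by (intro open_Collect_less continuous_intros)
    qed (use True in \<open>auto simp: neuron_def relu_def inner_x_1\<close>)
    then show ?thesis using True by (simp add: neuron_slope_def)
  next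
    case False
    have "((\<lambda>x. 0) has_real_derivative 0) (at x)" by simp
    then have "((\<lambda>x. neuron x w) has_real_derivative 0) (at x)"
    proof (rule has_field_derivative_transform_within_open)
      show "open {x. fst w * x + snd w < 0}" by (intro open_Collect_less continuous_intros)
    qed (use False nz in \<open>auto simp: neuron_def relu_def inner_x_1\<close>)
    then show ?thesis using False by (simp add: neuron_slope_def)
  qed
  \<comment> \<open>If \<open>fst w = 0\<close> the neuron is constant in \<open>x\<close> and has
    no kink, even when the affine argument is zero. Otherwise the only kink is at
    \<open>- snd w / fst w\<close>.\<close>
  moreover have "neuron_slope x w = 0 \<and> neuron y w = neuron x w" if "fst w = 0" for x y
    using that by (simp add: neuron_slope_def neuron_def inner_x_1)
  then have "((\<lambda>x. neuron x w) has_real_derivative neuron_slope x w) (at x)" if "fst w = 0" for x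
    using that by (metis (no_types, lifting) DERIV_const DERIV_cong_ev eventually_sequentially ext)
  ultimately have "\<forall>x\<in>{c<..<d} - {- snd w / fst w}. ((\<lambda>x. neuron x w) has_real_derivative neuron_slope x w) (at x)"
    by (cases "fst w = 0") (auto simp: inner_x_1 field_simps eq_neg_iff_add_eq_0)
  then show "\<exists>S. finite S \<and> (\<forall>x\<in>{c<..<d} - S. ((\<lambda>x. neuron x w) has_real_derivative neuron_slope x w) (at x))"
    by (intro exI[of _ "{- snd w / fst w}"]) simp
qed

lemma abs_neuron_slope_le: "norm w \<le> 1 \<Longrightarrow> \<bar>neuron_slope x w\<bar> \<le> 1"
  using norm_fst_le[of "fst w" "snd w"] by (simp add: neuron_slope_def)

lemma abs_neuron_diff_le:
  assumes "norm w \<le> 1"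
  shows "\<bar>neuron x w - neuron y w\<bar> \<le> \<bar>x - y\<bar>"
proof -
  have "\<bar>neuron x w - neuron y w\<bar> \<le> \<bar>fst w * (x - y)\<bar>"
    by (auto simp: neuron_def relu_def inner_x_1 right_diff_distrib)
  also have "\<dots> \<le> 1 * \<bar>x - y\<bar>"
    unfolding abs_mult using assms norm_fst_le[of "fst w" "snd w"] by (intro mult_right_mono) auto
  finally show ?thesis by simp
qed

lemma abs_neuron_le: "norm w \<le> 1 \<Longrightarrow> \<bar>neuron x w\<bar> \<le> \<bar>x\<bar> + 1"
proof -
  assume w: "norm w \<le> 1"
  have "\<bar>neuron 0 w\<bar> \<le> 1"
    using w norm_snd_le[of "snd w" "fst w"] by (simp add: neuron_def relu_def inner_x_1)
  then show ?thesis using abs_neuron_diff_le[OF w, of x 0] by simp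
qed

text \<open>On the unit circle every neuron is 1-Lipschitz in \<open>x\<close>, so the constant 1
  dominates slopes and difference quotients and is integrable for the finite measure
  \<open>Q\<close>. Both limits then come from dominated convergence, with the same integrand
  \<open>neuron_slope0\<close>.\<close>

lemma neuron_integral:
  assumes Q: "finite_measure Q" and sQ: "sets Q = sets circle_borel"
  shows neuron_integral_weak_derivative:
      "has_weak_derivative {a<..<b} (\<lambda>x. LINT w|Q. neuron x w) (\<lambda>x. LINT w|Q. neuron_slope x w)"
    and neuron_slope_integral_tendsto:
      "((\<lambda>x. LINT w|Q. neuron_slope x w) \<longlongrightarrow> (LINT w|Q. neuron_slope0 w)) (at_right 0)"
    and neuron_integral_quotient_tendsto:
      "((\<lambda>x. ((LINT w|Q. neuron x w) - (LINT w|Q. neuron 0 w)) / x) \<longlongrightarrow> (LINT w|Q. neuron_slope0 w)) (at_right 0)"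
proof -
  interpret finite_measure Q by fact
  have nQ: "norm w = 1" if "w \<in> space Q" for w
    using that sets_eq_imp_space_eq[OF sQ] by (auto simp: circle_borel_def space_restrict_space)
  have "(\<lambda>w. w) \<in> Q \<rightarrow>\<^sub>M borel"
    unfolding measurable_cong_sets[OF sQ refl] circle_borel_def
    by (rule measurable_restrict_space1) simp
  then have [measurable]: "fst \<in> borel_measurable Q" "snd \<in> borel_measurable Q"
    by (auto intro: borel_measurable_continuous_on[OF continuous_on_fst[OF continuous_on_id]]
        borel_measurable_continuous_on[OF continuous_on_snd[OF continuous_on_id]])
  show "has_weak_derivative {a<..<b} (\<lambda>x. LINT w|Q. neuron x w) (\<lambda>x. LINT w|Q. neuron_slope x w)"
  proof (rule has_weak_derivative_integral[OF Q open_greaterThanLessThan _ _ _ neuron_has_weak_derivative])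
    show "case_prod neuron \<in> borel_measurable (lborel \<Otimes>\<^sub>M Q)"
      unfolding neuron_def relu_def inner_x_1 by measurable
    show "case_prod neuron_slope \<in> borel_measurable (lborel \<Otimes>\<^sub>M Q)"
      unfolding neuron_slope_def inner_x_1 by measurable
    fix K :: "real set" assume "compact K"
    then obtain C where C: "\<And>x. x \<in> K \<Longrightarrow> \<bar>x\<bar> \<le> C"
      using compact_imp_bounded[of K] unfolding bounded_iff by auto
    have "\<bar>neuron x w\<bar> \<le> \<bar>C\<bar> + 1 \<and> \<bar>neuron_slope x w\<bar> \<le> \<bar>C\<bar> + 1" if "x \<in> K" "w \<in> space Q" for x w
      using abs_neuron_le[of w x] abs_neuron_slope_le[of w x] C[OF that(1)] nQ[OF that(2)] by linarith
    then show "\<exists>C. \<forall>x\<in>K. \<forall>w\<in>space Q. \<bar>neuron x w\<bar> \<le> C \<and> \<bar>neuron_slope x w\<bar> \<le> C" by blast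
  qed
  have m [measurable]: "neuron x \<in> borel_measurable Q" "neuron_slope x \<in> borel_measurable Q"
    "neuron_slope0 \<in> borel_measurable Q" for x
    unfolding neuron_def[abs_def] relu_def neuron_slope_def[abs_def] neuron_slope0_def[abs_def] inner_x_1
    by measurable
  show "((\<lambda>x. LINT w|Q. neuron_slope x w) \<longlongrightarrow> (LINT w|Q. neuron_slope0 w)) (at_right 0)"
    by (rule integral_dominated_convergence_at_right[where v = "\<lambda>_. 1"])
      (auto intro: neuron_slope_tendsto abs_neuron_slope_le simp: nQ)
  have int: "integrable Q (neuron x)" for x
    by (rule integrable_const_bound[of _ "\<bar>x\<bar> + 1"]) (auto intro!: AE_I2 abs_neuron_le simp: nQ)
  have "((\<lambda>x. LINT w|Q. (neuron x w - neuron 0 w) / x) \<longlongrightarrow> (LINT w|Q. neuron_slope0 w)) (at_right 0)"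
  proof (rule integral_dominated_convergence_at_right[where v = "\<lambda>_. 1"])
    fix x :: real and w assume "0 < x" "w \<in> space Q"
    then show "\<bar>(neuron x w - neuron 0 w) / x\<bar> \<le> 1"
      using abs_neuron_diff_le[of w x 0] nQ[of w] by (simp add: abs_divide)
  qed (auto intro: neuron_quotient_tendsto)
  moreover have "(LINT w|Q. (neuron x w - neuron 0 w) / x) = ((LINT w|Q. neuron x w) - (LINT w|Q. neuron 0 w)) / x" for x
    using Bochner_Integration.integral_diff[OF int int, of x 0] by simp
  ultimately show "((\<lambda>x. ((LINT w|Q. neuron x w) - (LINT w|Q. neuron 0 w)) / x) \<longlongrightarrow> (LINT w|Q. neuron_slope0 w)) (at_right 0)"
    by (simp only:)
qed

text \<open>The signed integral is a difference of integrals over two finite measures, the positive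
  and negative variations, and everything is linear. The point is that one \<open>L\<close> serves
  both limits.\<close>

lemma barron_slope_at_0:
  assumes "f \<in> barron"
  obtains g L where "has_weak_derivative {a<..<b} f g" "(g \<longlongrightarrow> L) (at_right 0)"
    "((\<lambda>x. (f x - f 0) / x) \<longlongrightarrow> L) (at_right 0)"
proof -
  obtain \<mu> where \<mu>: "finite_signed_measure circle_borel \<mu>"
    and f: "\<And>x. f x = signed_integral circle_borel \<mu> (\<lambda>w. relu (w \<bullet> (x, 1)))"
    using assms unfolding barron_def by blast
  define P where "P = positive_variation circle_borel \<mu>"
  define N where "N = negative_variation circle_borel \<mu>"
  have f': "f = (\<lambda>x. (LINT w|P. neuron x w) - (LINT w|N. neuron x w))"
    unfolding f signed_integral_def neuron_def P_def N_def ..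
  have P: "finite_measure P" "sets P = sets circle_borel" and N: "finite_measure N" "sets N = sets circle_borel"
    using \<mu> by (simp_all add: P_def N_def finite_measure_positive_variation finite_measure_negative_variation)
  show ?thesis
  proof (rule that)
    show "has_weak_derivative {a<..<b} f (\<lambda>x. (LINT w|P. neuron_slope x w) - (LINT w|N. neuron_slope x w))"
      unfolding f' by (intro has_weak_derivative_diff neuron_integral_weak_derivative P N)
    show "((\<lambda>x. (LINT w|P. neuron_slope x w) - (LINT w|N. neuron_slope x w)) \<longlongrightarrow> (LINT w|P. neuron_slope0 w) - (LINT w|N. neuron_slope0 w)) (at_right 0)"
      by (intro tendsto_diff neuron_slope_integral_tendsto P N)
    have eq: "(f x - f 0) / x = ((LINT w|P. neuron x w) - (LINT w|P. neuron 0 w)) / x - ((LINT w|N. neuron x w) - (LINT w|N. neuron 0 w)) / x" for x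
      unfolding f' by (simp add: diff_divide_distrib)
    show "((\<lambda>x. (f x - f 0) / x) \<longlongrightarrow> (LINT w|P. neuron_slope0 w) - (LINT w|N. neuron_slope0 w)) (at_right 0)"
      unfolding eq by (intro tendsto_diff neuron_integral_quotient_tendsto P N)
  qed
qed

text \<open>For the zero measure both variations are the same measure, so the two integrals
  cancel.\<close>

lemma zero_in_barron: "(\<lambda>x. 0) \<in> barron"
proof -
  have "finite_signed_measure circle_borel (\<lambda>A. 0)"
    by (simp add: finite_signed_measure_def)
  then show ?thesis
    unfolding barron_def signed_integral_def negative_variation_def by force
qed

section \<open>The infima\<close>

lemma nn_integral_inverse_at_0:
  assumes e: "0 < e"
  shows "(\<integral>\<^sup>+x\<in>{0<..<e::real}. ennreal (1 / x) \<partial>lborel) = \<infinity>"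
proof (rule ccontr)
  assume "\<not> ?thesis"
  then obtain r where r: "0 \<le> r" "(\<integral>\<^sup>+x\<in>{0<..<e}. ennreal (1 / x) \<partial>lborel) = ennreal r"
    by (cases "\<integral>\<^sup>+x\<in>{0<..<e}. ennreal (1 / x) \<partial>lborel") auto
  define b where "b = e / 2"
  \<comment> \<open>Chosen so that the integral of 1/x over [a,b] is exactly \<open>r + 1\<close>,
    exceeding the supposed total \<open>r\<close>.\<close>
  define a where "a = b * exp (- (r + 1))"
  have b: "0 < b" "b < e" and a: "0 < a" "a \<le> b" using e r by (auto simp: a_def b_def)
  have "ennreal (ln b - ln a) = (\<integral>\<^sup>+x. ennreal (1 / x) * indicator {a..b} x \<partial>lborel)"
  proof (rule nn_integral_FTC_Icc[symmetric])
    fix x assume "x \<in> {a..b}"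
    then show "DERIV ln x :> 1 / x" "0 \<le> 1 / x" using a by (auto intro!: derivative_eq_intros)
  qed (use a in auto)
  also have "\<dots> \<le> ennreal r"
    unfolding r(2)[symmetric] using a b by (intro nn_integral_mono) (auto split: split_indicator)
  finally have "ln b - ln a \<le> r" using r by simp
  moreover have "ln b - ln a = r + 1" using b by (simp add: a_def ln_mult)
  ultimately show False by simp
qed

text \<open>A value below 1 would bound the slopes away from 0 through the second summand, and that
  in turn makes the first summand infinite.\<close>

lemma one_le_J:
  assumes wd: "has_weak_derivative {0<..<1} u g" and g: "(g \<longlongrightarrow> L) (at_right 0)"
    and q: "((\<lambda>x. (u x - u 0) / x) \<longlongrightarrow> L) (at_right 0)"
  shows "1 \<le> J u"
proof (rule ccontr)
  let ?N = "Linf_norm {0<..<1} (\<lambda>x. \<bar>weak_deriv {0<..<1} u x\<bar> - 1)"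
  let ?I = "\<integral>\<^sup>+x\<in>{0<..<1}. ennreal ((u x)\<^sup>2 / x ^ 3) \<partial>lebesgue"
  assume "\<not> 1 \<le> J u"
  then have J1: "?I + ?N < 1" by (simp add: J_def not_le)
  have "?N \<le> ?I + ?N" by simp
  then have "?N < 1" using J1 by (rule order.strict_trans1)
  then obtain r where r: "0 \<le> r" "?N = ennreal r" "r < 1"
    by (cases ?N) auto
  have "AE x in lebesgue_on {0<..<1}. ennreal \<bar>\<bar>weak_deriv {0<..<1} u x\<bar> - 1\<bar> \<le> ennreal r"
    unfolding r(2)[symmetric] Linf_norm_def by (rule esssup_AE)
  then have "AE x in lebesgue. x \<in> {0<..<1} \<longrightarrow> ennreal \<bar>\<bar>weak_deriv {0<..<1} u x\<bar> - 1\<bar> \<le> ennreal r"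
    by (subst (asm) AE_restrict_space_iff) auto
  moreover have "AE x in lebesgue. x \<in> {0<..<1} \<longrightarrow> weak_deriv {0<..<1} u x = g x"
    by (rule weak_deriv_AE_eq[OF _ wd]) simp
  ultimately have gr: "AE x in lebesgue. x \<in> {0<..<1} \<longrightarrow> 1 - r \<le> \<bar>g x\<bar>"
    by eventually_elim (use r in \<open>auto simp: ennreal_le_iff\<close>)
  \<comment> \<open>Otherwise \<open>\<bar>g x\<bar> < 1 - r\<close> on a whole interval to the
    right of 0, which has positive measure, against \<open>gr\<close>.\<close>
  have L: "1 - r \<le> \<bar>L\<bar>"
  proof (rule ccontr)
    assume "\<not> 1 - r \<le> \<bar>L\<bar>"
    then have "\<forall>\<^sub>F x in at_right 0. \<bar>g x\<bar> < 1 - r"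
      by (intro order_tendstoD(2)[OF tendsto_rabs[OF g]]) simp
    then obtain e where e: "0 < e" "\<And>x. 0 < x \<Longrightarrow> x < e \<Longrightarrow> \<bar>g x\<bar> < 1 - r"
      by (auto simp: eventually_at_right_field)
    have "AE x in lebesgue. x \<notin> {0<..<min e 1}"
      using gr by eventually_elim (use e(2) in force)
    then have "{0<..<min e 1} \<in> null_sets lebesgue"
      by (subst AE_iff_null_sets) auto
    then show False using e(1) by (auto simp: null_sets_def min_def split: if_splits)
  qed
  \<comment> \<open>By \<open>q\<close>, \<open>u 0\<close> is the right limit of \<open>u\<close>
    at 0. If it is zero, \<open>u\<close> grows at least at rate \<open>\<bar>L\<bar> / 2\<close>;
    if not, \<open>\<bar>u x\<bar>\<close> stays above \<open>\<bar>u 0\<bar> / 2\<close>, which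
    dominates a multiple of x for x < 1.\<close>
  have "\<exists>c e. 0 < c \<and> 0 < e \<and> (\<forall>x. 0 < x \<longrightarrow> x < e \<longrightarrow> c * x \<le> \<bar>u x\<bar>)"
  proof (cases "u 0 = 0")
    case True
    have "\<forall>\<^sub>F x in at_right 0. \<bar>L\<bar> / 2 < \<bar>(u x - u 0) / x\<bar>"
      using L r by (intro order_tendstoD(1)[OF tendsto_rabs[OF q]]) simp
    then obtain e where e: "0 < e" "\<And>x. 0 < x \<Longrightarrow> x < e \<Longrightarrow> \<bar>L\<bar> / 2 < \<bar>(u x - u 0) / x\<bar>"
      by (auto simp: eventually_at_right_field)
    have "\<bar>L\<bar> / 2 * x \<le> \<bar>u x\<bar>" if "0 < x" "x < e" for x
      using e(2)[OF that] that True by (simp add: abs_divide field_simps)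
    then show ?thesis using e(1) L r by (intro exI[of _ "\<bar>L\<bar> / 2"] exI[of _ e]) auto
  next
    case False
    have "((\<lambda>x. u 0 + x * ((u x - u 0) / x)) \<longlongrightarrow> u 0 + 0 * L) (at_right 0)"
      by (intro tendsto_intros q)
    then have "((\<lambda>x. \<bar>u 0 + x * ((u x - u 0) / x)\<bar>) \<longlongrightarrow> \<bar>u 0\<bar>) (at_right 0)"
      by (intro tendsto_rabs) simp
    then have "\<forall>\<^sub>F x in at_right 0. \<bar>u 0\<bar> / 2 < \<bar>u 0 + x * ((u x - u 0) / x)\<bar>"
      using False by (intro order_tendstoD(1)) auto
    then obtain e where e: "0 < e" "\<And>x. 0 < x \<Longrightarrow> x < e \<Longrightarrow> \<bar>u 0\<bar> / 2 < \<bar>u 0 + x * ((u x - u 0) / x)\<bar>"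
      by (auto simp: eventually_at_right_field)
    have "\<bar>u 0\<bar> / 2 * x \<le> \<bar>u x\<bar>" if "0 < x" "x < min e 1" for x
    proof -
      have "\<bar>u 0\<bar> / 2 * x \<le> \<bar>u 0\<bar> / 2" using that by (intro mult_left_le) auto
      then show ?thesis using e(2)[of x] that by simp
    qed
    then show ?thesis using e(1) False by (intro exI[of _ "\<bar>u 0\<bar> / 2"] exI[of _ "min e 1"]) auto
  qed
  then obtain c e where c: "0 < c" and e: "0 < e" and lower: "\<And>x. 0 < x \<Longrightarrow> x < e \<Longrightarrow> c * x \<le> \<bar>u x\<bar>"
    by blast
  \<comment> \<open>The lower bound turns the integrand into at least \<open>c\<^sup>2 / x\<close>,
    whose integral near 0 diverges.\<close>
  have "\<infinity> = ennreal (c\<^sup>2) * (\<integral>\<^sup>+x\<in>{0<..<min e 1}. ennreal (1 / x) \<partial>lborel)"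
    using c e by (simp add: nn_integral_inverse_at_0 ennreal_mult_top)
  also have "\<dots> = (\<integral>\<^sup>+x. ennreal (c\<^sup>2) * (ennreal (1 / x) * indicator {0<..<min e 1} x) \<partial>lborel)"
    by (rule nn_integral_cmult[symmetric]) measurable
  also have "\<dots> = (\<integral>\<^sup>+x. ennreal (c\<^sup>2) * (ennreal (1 / x) * indicator {0<..<min e 1} x) \<partial>lebesgue)"
    by (rule nn_integral_completion[symmetric])
  also have "\<dots> \<le> ?I"
  proof (rule nn_integral_mono)
    fix x :: real
    show "ennreal (c\<^sup>2) * (ennreal (1 / x) * indicator {0<..<min e 1} x) \<le> ennreal ((u x)\<^sup>2 / x ^ 3) * indicator {0<..<1} x"
    proof (cases "x \<in> {0<..<min e 1}")
      case True
      then have "(c * x)\<^sup>2 \<le> (u x)\<^sup>2" using power_mono[OF lower[of x], of 2] c by simp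
      then have "c\<^sup>2 * (1 / x) \<le> (u x)\<^sup>2 / x ^ 3"
        using True by (simp add: power_mult_distrib field_simps eval_nat_numeral)
      then show ?thesis using True by (simp add: ennreal_mult'[symmetric] ennreal_leI)
    qed simp
  qed
  also have "\<dots> \<le> ?I + ?N" by simp
  finally have "\<infinity> \<le> ?I + ?N" .
  from order.strict_trans1[OF this J1] show False by simp
qed

theorem theorem5:
  shows "(INF u \<in> W1_inf {0<..<1}. J u) = 0 \<and> (INF u \<in> barron. J u) = 1"
proof
  have le: "(INF u \<in> W1_inf {0<..<1}. J u) \<le> ennreal d" if "0 < d" for d
  proof -
    \<comment> \<open>With \<open>\<epsilon> \<le> 1\<close> the square is at most
      \<open>\<epsilon>\<close>, so the two error terms add up to at most
      \<open>8 * \<epsilon> \<le> d\<close>.\<close>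
    define \<epsilon> where "\<epsilon> = min 1 (d / 8)"
    have \<epsilon>: "0 < \<epsilon>" "\<epsilon> \<le> 1" "8 * \<epsilon> \<le> d" using that by (auto simp: \<epsilon>_def)
    obtain u where u: "u \<in> W1_inf {0<..<1}" "J u \<le> ennreal (4 * \<epsilon>\<^sup>2) + ennreal (4 * \<epsilon>)"
      using ex_J_le[OF \<epsilon>(1)] by blast
    have "\<epsilon>\<^sup>2 \<le> \<epsilon>" using \<epsilon> by (simp add: power2_eq_square mult_left_le)
    then have "4 * \<epsilon>\<^sup>2 + 4 * \<epsilon> \<le> d" using \<epsilon> by linarith
    then have "ennreal (4 * \<epsilon>\<^sup>2) + ennreal (4 * \<epsilon>) \<le> ennreal d"
      using \<epsilon> by (simp add: ennreal_plus[symmetric] ennreal_leI del: ennreal_plus)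
    with u show ?thesis by (meson INF_lower2 order_trans)
  qed
  have "(INF u \<in> W1_inf {0<..<1}. J u) \<le> 0"
  proof (rule ennreal_le_epsilon)
    fix e :: real assume "0 < e"
    from le[OF this] show "(INF u \<in> W1_inf {0<..<1}. J u) \<le> 0 + ennreal e" by (simp only: add_0)
  qed
  then show "(INF u \<in> W1_inf {0<..<1}. J u) = 0" by (simp only: le_zero_eq)
next
  show "(INF u \<in> barron. J u) = 1"
  proof (rule antisym)
    have "has_weak_derivative {0<..<1} (\<lambda>x. 0) (\<lambda>x. 0)"
      by (simp add: has_weak_derivative_def locally_integrable_def set_integrable_def)
    \<comment> \<open>For the zero function the integrand is 0 and the slope misses modulus 1 by
      exactly 1.\<close>
    then have "J (\<lambda>x. 0) \<le> ennreal 0 + ennreal 1" by (rule J_le) auto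
    then show "(INF u \<in> barron. J u) \<le> 1"
      by (intro INF_lower2[OF zero_in_barron]) simp
    show "1 \<le> (INF u \<in> barron. J u)"
    proof (rule INF_greatest)
      fix u assume "u \<in> barron"
      then show "1 \<le> J u"
        by (rule barron_slope_at_0[of _ 0 1]) (rule one_le_J)
    qed
  qed
qed

end
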